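(* For every $n\in\mathbb{N}=\{1,2,\ldots\}$ there exists a holomorphic contact form $\alpha$ on $\mathbb{C}^{2n+1}$ such that any holomorphic map $f\colon\mathbb{C}\to\mathbb{C}^{2n+1}$ satisfying $f^*\alpha=0$ is constant. In particular, the complex contact manifold $(\mathbb{C}^{2n+1},\alpha)$ is not contactomorphic to $(\mathbb{C}^{2n+1},\alpha_0)$, where $\alpha_0=dz+\sum_{j=1}^n x_j\,dy_j$.
   Context: A holomorphic contact form on a complex manifold $M$ of dimension $2n+1\ge 3$ is a holomorphic $1$-form $\alpha$ on $M$ such that $\alpha\wedge(d\alpha)^n\neq 0$ at every point of $M$. The pair $(M,\alpha)$ denotes the complex contact manifold $(M,\xi)$ with the holomorphic contact subbundle $\xi=\ker\alpha\subset TM$. Coordinates on $\mathbb{C}^{2n+1}$ are $(x_1,y_1,\ldots,x_n,y_n,z)$, and $\alpha_0=dz+\sum_{j=1}^n x_j\,dy_j$ is the standard complex contact form. Two complex contact manifolds $(M,\xi)$ and $(M',\xi')$ are contactomorphic if there is a biholomorphic map $F\colon M\to M'$ whose differential satisfies $dF(\xi)=\xi'$. *)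

theory Defs
  imports "HOL-Analysis.Analysis"
begin

text \<open>The coordinates $(x_1,y_1,\ldots,x_n,y_n,z)$ of $\mathbb{C}^{2n+1}$, with
  \<open>n = CARD('n)\<close>, are indexed by the type \<open>'n + 'n + unit\<close>. Tangent vectors at a point
  are elements of the same space.\<close>

type_synonym 'n cspace = "complex ^ ('n + 'n + unit)"

abbreviation xcoord :: "'n::finite cspace \<Rightarrow> 'n \<Rightarrow> complex" where
  "xcoord p j \<equiv> p $ Inl j"

abbreviation ycoord :: "'n::finite cspace \<Rightarrow> 'n \<Rightarrow> complex" where
  "ycoord p j \<equiv> p $ Inr (Inl j)"

abbreviation zcoord :: "'n::finite cspace \<Rightarrow> complex" where
  "zcoord p \<equiv> p $ Inr (Inr ())"

definition holomorphic_fun :: "(complex ^ 'd::finite \<Rightarrow> complex) \<Rightarrow> bool" where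
  "holomorphic_fun f \<longleftrightarrow>
     (\<forall>p. \<exists>D. (f has_derivative D) (at p) \<and> Vector_Spaces.linear (*s) (*) D)"

definition holomorphic_map :: "(complex ^ 'd::finite \<Rightarrow> complex ^ 'e::finite) \<Rightarrow> bool" where
  "holomorphic_map F \<longleftrightarrow> (\<forall>i. holomorphic_fun (\<lambda>p. F p $ i))"

definition holomorphic_curve :: "(complex \<Rightarrow> complex ^ 'd::finite) \<Rightarrow> bool" where
  "holomorphic_curve f \<longleftrightarrow> (\<forall>i. (\<lambda>t. f t $ i) holomorphic_on UNIV)"

definition biholomorphic :: "(complex ^ 'd::finite \<Rightarrow> complex ^ 'e::finite) \<Rightarrow> bool" where
  "biholomorphic F \<longleftrightarrow> bij F \<and> holomorphic_map F \<and> holomorphic_map (inv F)"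

text \<open>A 1-form \<open>\<alpha>\<close> assigns to a point \<open>p\<close> the covector \<open>\<alpha> p\<close>. It is holomorphic iff its
  coefficients with respect to $dx_j, dy_j, dz$ are.\<close>

definition holomorphic_1form :: "(complex ^ 'd::finite \<Rightarrow> complex ^ 'd \<Rightarrow> complex) \<Rightarrow> bool" where
  "holomorphic_1form \<alpha> \<longleftrightarrow>
     (\<forall>p. Vector_Spaces.linear (*s) (*) (\<alpha> p)) \<and>
     (\<forall>i. holomorphic_fun (\<lambda>p. \<alpha> p (axis i 1)))"

text \<open>An alternating \<open>k\<close>-linear form at a point is represented as a function of a sequence
  \<open>v\<close> of vectors that depends on \<open>v 0, \<dots>, v (k - 1)\<close> only. The normalisation of the wedge
  product is the one for which $(dx_1\wedge dx_2)(e_1,e_2)=1$.\<close>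

definition wedge ::
  "nat \<Rightarrow> nat \<Rightarrow> ((nat \<Rightarrow> 'v) \<Rightarrow> complex) \<Rightarrow> ((nat \<Rightarrow> 'v) \<Rightarrow> complex) \<Rightarrow> (nat \<Rightarrow> 'v) \<Rightarrow> complex" where
  "wedge k l a b v =
     (\<Sum>\<sigma> | \<sigma> permutes {..<k + l}.
        of_int (sign \<sigma>) * a (\<lambda>i. v (\<sigma> i)) * b (\<lambda>i. v (\<sigma> (k + i)))) / (fact k * fact l)"

primrec wedge_power2 :: "((nat \<Rightarrow> 'v) \<Rightarrow> complex) \<Rightarrow> nat \<Rightarrow> (nat \<Rightarrow> 'v) \<Rightarrow> complex" where
  "wedge_power2 \<omega> 0 = (\<lambda>v. 1)"
| "wedge_power2 \<omega> (Suc m) = wedge 2 (2 * m) \<omega> (wedge_power2 \<omega> m)"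

text \<open>$d\alpha(u,v)=u(\alpha(v))-v(\alpha(u))$ for constant vector fields $u$, $v$ (whose Lie
  bracket vanishes).\<close>

definition ext_deriv ::
  "('v::real_normed_vector \<Rightarrow> 'v \<Rightarrow> complex) \<Rightarrow> 'v \<Rightarrow> 'v \<Rightarrow> 'v \<Rightarrow> complex" where
  "ext_deriv \<alpha> p u v =
     frechet_derivative (\<lambda>q. \<alpha> q v) (at p) u - frechet_derivative (\<lambda>q. \<alpha> q u) (at p) v"

definition holomorphic_contact_form :: "('n::finite cspace \<Rightarrow> 'n cspace \<Rightarrow> complex) \<Rightarrow> bool" where
  "holomorphic_contact_form \<alpha> \<longleftrightarrow>
     holomorphic_1form \<alpha> \<and>
     (\<forall>p. wedge 1 (2 * CARD('n)) (\<lambda>v. \<alpha> p (v 0))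
            (wedge_power2 (\<lambda>v. ext_deriv \<alpha> p (v 0) (v 1)) CARD('n)) \<noteq> (\<lambda>v. 0))"

definition standard_contact_form :: "'n::finite cspace \<Rightarrow> 'n cspace \<Rightarrow> complex" where
  "standard_contact_form p v = zcoord v + (\<Sum>j\<in>UNIV. xcoord p j * ycoord v j)"

definition pullback ::
  "('u::real_normed_vector \<Rightarrow> 'v::real_normed_vector) \<Rightarrow> ('v \<Rightarrow> 'v \<Rightarrow> complex) \<Rightarrow> 'u \<Rightarrow> 'u \<Rightarrow> complex" where
  "pullback f \<alpha> t w = \<alpha> (f t) (frechet_derivative f (at t) w)"

definition contact_subspace :: "('v \<Rightarrow> 'v \<Rightarrow> complex) \<Rightarrow> 'v \<Rightarrow> 'v set" where
  "contact_subspace \<alpha> p = {v. \<alpha> p v = 0}"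

definition contactomorphic ::
  "(complex ^ 'd::finite \<Rightarrow> complex ^ 'd \<Rightarrow> complex) \<Rightarrow>
   (complex ^ 'd \<Rightarrow> complex ^ 'd \<Rightarrow> complex) \<Rightarrow> bool" where
  "contactomorphic \<alpha> \<beta> \<longleftrightarrow>
     (\<exists>F. biholomorphic F \<and>
        (\<forall>p. frechet_derivative F (at p) ` contact_subspace \<alpha> p = contact_subspace \<beta> (F p)))"

end

theory Submission
  imports Defs "HOL-Complex_Analysis.Conformal_Mappings" "HOL-Real_Asymp.Real_Asymp"
begin

text \<open>
  The contact form is explicit. Let \<open>e\<close> number the coordinates of the space injectively, with
  number \<open>0\<close> for \<open>z\<close>, and let \<open>E(p) = \<Sum>\<^sub>i \<Sum>\<^sub>\<omega> exp (\<omega> p\<^sub>i)\<close>, where \<open>\<omega>\<close> runs through the roots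
  of unity of order \<open>2 ^ e i\<close>. Put \<open>\<alpha> = dE + \<Sum>\<^sub>j x\<^sub>j dy\<^sub>j\<close>, the pull-back of the standard contact
  form under the map \<open>(x, y, z) \<mapsto> (x, y, E)\<close>. This map is locally biholomorphic, because \<open>E\<close>
  depends on \<open>z\<close> only through the summand \<open>exp z\<close>, so \<open>\<alpha>\<close> is a contact form.

  Suppose that a nonconstant entire curve \<open>f\<close> is tangent to \<open>ker \<alpha>\<close>. By Hadamard's three circles
  theorem the logarithm of the maximum of \<open>\<parallel>f\<parallel>\<close> over the circle of radius \<open>exp s\<close> is a convex
  function of \<open>s\<close>. A convex function that increases to infinity looks, near suitable points and
  on the scale on which it grows by a bounded amount, like a linear function. At such
  a point \<open>c\<close> the rescaled curve \<open>\<tau> \<mapsto> f (exp (c + \<mu> \<tau>))\<close> is close to \<open>\<tau> \<mapsto> exp \<tau> \<cdot> a\<close> with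
  \<open>a = f (exp c)\<close>, uniformly on a large disc, with an error that is small compared with \<open>\<parallel>a\<parallel>\<close>, and
  \<open>\<parallel>a\<parallel>\<close> can be taken as large as desired (\<open>wiman_valiron\<close>, in the spirit of Wiman-Valiron theory).

  Along the rescaled curve both the position and the velocity are therefore approximately
  \<open>\<kappa> a\<close>, where the phase \<open>\<kappa> = exp \<tau>\<close>, \<open>\<parallel>\<kappa>\<parallel> = 1\<close>, is at our disposal. The equation
  \<open>\<alpha>(f') = 0\<close> is a vanishing sum of terms \<open>\<omega> u\<^sub>i exp (\<omega> p\<^sub>i)\<close>, plus a quadratic remainder. If for
  some \<open>\<kappa>\<close> one exponent \<open>\<omega> p\<^sub>i \<approx> \<kappa> \<omega> a\<^sub>i\<close> has a real part that exceeds zero and all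
  the other real parts by a fixed multiple of \<open>\<parallel>a\<parallel>\<close>, then its term, whose coefficient \<open>u\<^sub>i \<approx> \<kappa> a\<^sub>i\<close> is
  then not small either, cannot be cancelled. Such a \<open>\<kappa>\<close> always exists
  (\<open>untied_exponent\<close>): the coordinates of maximal modulus \<open>r\<close> contribute points \<open>\<omega> a\<^sub>i\<close> on
  the circle of radius \<open>r\<close>, and since \<open>2 ^ k\<close> exceeds the sum of all smaller powers of two, the
  coordinate with the largest number contributes more points than the others
  together. One of its points is thus hit only once, and \<open>\<kappa>\<close> rotates this point to the positive axis.

  The standard contact structure, on the other hand, contains the complex line along
  \<open>x\<^sub>j\<close>, and a contactomorphism would carry it to a nonconstant entire curve tangent to \<open>ker \<alpha>\<close>.
\<close>

section \<open>Growth of entire curves\<close>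

lemma lim_const_over_succ: "(\<lambda>k. c / (real k + 1)) \<longlonglongrightarrow> 0"
  using LIMSEQ_Suc[OF lim_const_over_n[of c]] by (simp add: add.commute)

text \<open>
  By periodicity of the modulus, the supremum over the strip is a maximum over one period, hence attained, and the maximum
  modulus principle moves it to a boundary line. Applied to \<open>h (exp w) \<cdot> exp (- N w)\<close> with real
  \<open>N\<close>, this yields Hadamard's three circles theorem for an entire function \<open>h\<close>.
\<close>
lemma three_lines_periodic:
  fixes g :: "complex \<Rightarrow> complex"
  assumes hol: "g holomorphic_on UNIV"
    and per: "\<And>w. norm (g (w + 2 * of_real pi * \<i>)) = norm (g w)"
    and left: "\<And>w. Re w = a \<Longrightarrow> norm (g w) \<le> C"
    and right: "\<And>w. Re w = b \<Longrightarrow> norm (g w) \<le> C"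
    and w: "a \<le> Re w" "Re w \<le> b"
  shows "norm (g w) \<le> C"
proof -
  have cont: "continuous_on A g" for A
    using hol holomorphic_on_imp_continuous_on holomorphic_on_subset by blast
  have per_nat: "norm (g (u + of_nat k * (2 * of_real pi * \<i>))) = norm (g u)" for u k
  proof (induction k)
    case (Suc k)
    have "u + of_nat (Suc k) * (2 * of_real pi * \<i>)
        = (u + of_nat k * (2 * of_real pi * \<i>)) + 2 * of_real pi * \<i>"
      by (simp add: algebra_simps)
    then show ?case using per Suc.IH by metis
  qed simp
  have per_int: "norm (g (u + of_int k * (2 * of_real pi * \<i>))) = norm (g u)" for u k
  proof (cases "k \<ge> 0")
    case True
    then show ?thesis using per_nat[of u "nat k"] by (metis of_int_of_nat_eq nat_0_le)
  next
    case False
    then obtain m where m: "k = - int m"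
      by (metis linorder_le_cases nat_0_le neg_0_le_iff_le minus_minus)
    show ?thesis
      using per_nat[of "u + of_int k * (2 * of_real pi * \<i>)" m] by (simp add: m)
  qed
  define R where "R = cbox (Complex a 0) (Complex b (2 * pi))"
  have to_R: "\<exists>u'\<in>R. norm (g u') = norm (g u)" if u: "a \<le> Re u" "Re u \<le> b" for u
  proof -
    define k where "k = \<lfloor>Im u / (2 * pi)\<rfloor>"
    define u' where "u' = u + of_int (- k) * (2 * of_real pi * \<i>)"
    have Im: "Im u' = Im u - of_int k * (2 * pi)" and Re: "Re u' = Re u"
      by (simp_all add: u'_def)
    have "of_int k \<le> Im u / (2 * pi)" "Im u / (2 * pi) < of_int k + 1"
      unfolding k_def by linarith+
    then have "0 \<le> Im u'" "Im u' \<le> 2 * pi"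
      unfolding Im by (simp_all add: field_simps)
    then have "u' \<in> R" using u Re by (auto simp: R_def in_cbox_complex_iff)
    moreover have "norm (g u') = norm (g u)" unfolding u'_def by (rule per_int)
    ultimately show ?thesis by blast
  qed
  have "compact R" "R \<noteq> {}"
    using to_R[OF w] by (auto simp: R_def)
  then obtain m where m: "m \<in> R" and mmax: "\<And>u. u \<in> R \<Longrightarrow> norm (g u) \<le> norm (g m)"
    using continuous_attains_sup[of R "\<lambda>u. norm (g u)"] continuous_on_norm[OF cont] by blast
  have max: "norm (g u) \<le> norm (g m)" if "a \<le> Re u" "Re u \<le> b" for u
    using to_R[OF that] mmax by metis
  have "norm (g m) \<le> C"
  proof (cases "Re m = a \<or> Re m = b")
    case True
    then show ?thesis using left right by blast
  next
    case False
    define S where "S = {u. a < Re u} \<inter> {u. Re u < b}"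
    have mS: "m \<in> S" using m False by (auto simp: S_def R_def in_cbox_complex_iff)
    have "open S" unfolding S_def by (intro open_Int open_halfspace_Re_gt open_halfspace_Re_lt)
    have "convex S" unfolding S_def by (intro convex_Int convex_halfspace_Re_gt convex_halfspace_Re_lt)
    have "g constant_on S"
    proof (rule maximum_modulus_principle[where U = S and \<xi> = m])
      show "g holomorphic_on S" using hol holomorphic_on_subset by blast
      show "connected S" using \<open>convex S\<close> by (rule convex_connected)
      show "\<And>z. z \<in> S \<Longrightarrow> norm (g z) \<le> norm (g m)" by (rule max) (auto simp: S_def)
    qed (use \<open>open S\<close> mS in auto)
    then have eq: "g u = g m" if "u \<in> S" for u using mS that unfolding constant_on_def by metis
    \<comment> \<open>\<open>g\<close> is constant on the open strip, so by continuity it has the same value at the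
      boundary point \<open>p\<close>, where the bound is given.\<close>
    define p where "p = Complex a (Im m)"
    have ab: "a < Re m" "Re m < b" using mS by (auto simp: S_def)
    have "(\<lambda>k. p + of_real ((Re m - a) / (real k + 1))) \<longlonglongrightarrow> p + of_real 0"
      by (intro tendsto_intros lim_const_over_succ)
    then have "(\<lambda>k. g (p + of_real ((Re m - a) / (real k + 1)))) \<longlonglongrightarrow> g p"
      using continuous_on_tendsto_compose[OF cont[of UNIV]] by fastforce
    moreover have "g (p + of_real ((Re m - a) / (real k + 1))) = g m" for k
    proof (rule eq)
      have "0 < (Re m - a) / (real k + 1)" "(Re m - a) / (real k + 1) \<le> Re m - a"
        using ab divide_left_mono[of 1 "real k + 1" "Re m - a"] by auto
      then show "p + of_real ((Re m - a) / (real k + 1)) \<in> S"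
        using ab by (auto simp: S_def p_def)
    qed
    ultimately have "g p = g m" by (simp add: LIMSEQ_const_iff)
    then show ?thesis using left[of p] by (simp add: p_def)
  qed
  then show ?thesis using max[OF w] by linarith
qed

text \<open>
  The Hermitian inner product reduces statements about the Euclidean norm of a curve to
  statements about the scalar holomorphic functions \<open>t \<mapsto> \<langle>f t, a\<rangle>\<close>.
\<close>
definition herm :: "complex ^ 'd::finite \<Rightarrow> complex ^ 'd \<Rightarrow> complex" where
  "herm a b = (\<Sum>i\<in>UNIV. a $ i * cnj (b $ i))"

lemma herm_self: "herm a a = of_real ((norm a)\<^sup>2)"
proof -
  have "(norm a)\<^sup>2 = (\<Sum>i\<in>UNIV. (norm (a $ i))\<^sup>2)"
    by (simp add: norm_vec_def L2_set_def sum_nonneg)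
  then show ?thesis by (simp add: herm_def complex_norm_square[symmetric] del: of_real_power)
qed

lemma norm_herm_self: "norm (herm a a) = norm a * norm a"
  by (simp only: herm_self norm_of_real) (simp add: power2_eq_square)

lemma Re_herm: "Re (herm a b) = a \<bullet> b"
  by (simp add: herm_def inner_vec_def inner_complex_def)

lemma norm_herm_le: "norm (herm a b) \<le> norm a * norm b"
proof -
  have "norm (herm a b) \<le> (\<Sum>i\<in>UNIV. norm (a $ i) * norm (b $ i))"
    unfolding herm_def by (rule order_trans[OF norm_sum]) (simp add: norm_mult)
  also have "\<dots> \<le> norm a * norm b"
    using L2_set_mult_ineq[of "\<lambda>i. norm (a $ i)" "\<lambda>i. norm (b $ i)" UNIV]
    by (simp add: norm_vec_def)
  finally show ?thesis .
qed

lemma herm_scale: "herm (c *s a) b = c * herm a b"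
  by (simp add: herm_def sum_distrib_left mult.assoc)

definition log_max :: "(complex \<Rightarrow> complex ^ 'd::finite) \<Rightarrow> real \<Rightarrow> real" where
  "log_max f s = ln (SUP t\<in>sphere 0 (exp s). norm (f t))"

lemma holomorphic_curve_continuous:
  assumes "holomorphic_curve f" shows "continuous_on A f"
proof -
  have "continuous_on UNIV (\<lambda>t. \<chi> i. f t $ i)"
    using assms unfolding holomorphic_curve_def
    by (intro continuous_on_vec_lambda holomorphic_on_imp_continuous_on) auto
  then show ?thesis by (auto intro: continuous_on_subset)
qed

text \<open>
  Consider the points \<open>s k\<close> at which the convex function \<open>B\<close> reaches the equidistant levels
  \<open>B s0 + k K\<close>. Their gaps decrease. If each gap were smaller than the previous one by the fixed
  factor \<open>q < 1\<close>, then the \<open>s k\<close> would stay bounded although the levels do not. So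
  there are two consecutive gaps with a ratio of at least \<open>q\<close>, and around the point between them \<open>B\<close> is
  almost linear: its increments over the distance \<open>h\<close> to the right and to the left
  are almost the same.
\<close>
lemma growth_scale:
  fixes B :: "real \<Rightarrow> real"
  assumes conv: "convex_on UNIV B" and mono: "mono B" and unb: "\<And>C. \<exists>s. B s > C"
    and K: "K > 0" and \<epsilon>: "0 < \<epsilon>" "\<epsilon> < K"
  obtains c h where "h > 0" "B c \<ge> C" "B (c + h) \<le> B c + K" "B (c - h) \<le> B c - K + \<epsilon>"
proof -
  have cont: "continuous_on A B" for A
    using convex_on_continuous[OF open_UNIV conv] continuous_on_subset by blast
  obtain s0 where s0: "B s0 > C" using unb by blast
  have "\<exists>s. B s = B s0 + real k * K" for k
  proof -
    obtain t where t: "B t > B s0 + real k * K" using unb by blast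
    moreover have "0 \<le> real k * K" using K by simp
    ultimately have "B s0 < B t" by linarith
    then have "s0 \<le> t" using mono by (metis linorder_le_cases monoD not_less)
    then show ?thesis
      using IVT'[of B s0 "B s0 + real k * K" t] t \<open>0 \<le> real k * K\<close> cont by fastforce
  qed
  then obtain s where s: "\<And>k. B (s k) = B s0 + real k * K" by metis
  have less: "s k < s (Suc k)" for k
  proof -
    have "B (s k) < B (s (Suc k))" using K by (simp add: s algebra_simps)
    then show ?thesis using mono by (metis linorder_le_less_linear monoD not_less)
  qed
  define q where "q = 1 - \<epsilon> / K"
  have q: "0 < q" "q < 1" using K \<epsilon> by (auto simp: q_def)
  have "\<exists>k. s (Suc (Suc k)) - s (Suc k) \<ge> q * (s (Suc k) - s k)"
  proof (rule ccontr)
    assume "\<not> ?thesis"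
    then have *: "s (Suc (Suc k)) - s (Suc k) \<le> q * (s (Suc k) - s k)" for k
      by (meson linorder_le_cases)
    have gap: "s (Suc k) - s k \<le> q ^ k * (s 1 - s 0)" for k
    proof (induction k)
      case (Suc k)
      have "q * (s (Suc k) - s k) \<le> q * (q ^ k * (s 1 - s 0))"
        using Suc q by (intro mult_left_mono) auto
      then show ?case using *[of k] by simp
    qed simp
    have "s k \<le> s 0 + (s 1 - s 0) / (1 - q)" for k
    proof -
      have "s k - s 0 = (\<Sum>j<k. s (Suc j) - s j)" by (simp add: sum_lessThan_telescope)
      also have "\<dots> \<le> (\<Sum>j<k. q ^ j * (s 1 - s 0))" by (intro sum_mono gap)
      also have "\<dots> = (\<Sum>j<k. q ^ j) * (s 1 - s 0)" by (simp add: sum_distrib_right)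
      also have "\<dots> \<le> (1 / (1 - q)) * (s 1 - s 0)"
      proof (intro mult_right_mono)
        have "(\<Sum>j<k. q ^ j) \<le> (\<Sum>j. q ^ j)"
          using q by (intro sum_le_suminf summable_geometric) auto
        then show "(\<Sum>j<k. q ^ j) \<le> 1 / (1 - q)" using q by (simp add: suminf_geometric)
      qed (use less[of 0] in auto)
      finally show ?thesis by simp
    qed
    then have bd: "B s0 + real k * K \<le> B (s 0 + (s 1 - s 0) / (1 - q))" for k
      using s mono by (metis monoD)
    obtain k where "real k * K > B (s 0 + (s 1 - s 0) / (1 - q)) - B s0"
      using reals_Archimedean3[OF K] by blast
    then show False using bd[of k] by linarith
  qed
  then obtain k where k: "s (Suc (Suc k)) - s (Suc k) \<ge> q * (s (Suc k) - s k)" by blast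
  define h1 where "h1 = s (Suc k) - s k"
  define h where "h = min h1 (s (Suc (Suc k)) - s (Suc k))"
  define c where "c = s (Suc k)"
  have h1: "h1 > 0" using less by (simp add: h1_def)
  have h: "h > 0" "h \<le> h1" "q * h1 \<le> h"
    using less q h1 k by (auto simp: h_def h1_def mult_le_cancel_right1)
  have "B (c + h) \<le> B (s (Suc (Suc k)))" by (rule monoD[OF mono]) (simp add: c_def h_def)
  also have "\<dots> = B c + K" by (simp add: c_def s algebra_simps)
  finally have up: "B (c + h) \<le> B c + K" .
  have "B (c - h) \<le> (1 - h / h1) * B c + (h / h1) * B (c - h1)"
  proof -
    have "B ((1 - h / h1) *\<^sub>R c + (h / h1) *\<^sub>R (c - h1)) \<le> (1 - h / h1) * B c + (h / h1) * B (c - h1)"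
      using h h1 by (intro convex_onD[OF conv]) auto
    moreover have "(1 - h / h1) *\<^sub>R c + (h / h1) *\<^sub>R (c - h1) = c - h"
      using h1 by (simp add: field_simps)
    ultimately show ?thesis by simp
  qed
  also have "B (c - h1) = B c - K" by (simp add: c_def h1_def s algebra_simps)
  also have "(1 - h / h1) * B c + (h / h1) * (B c - K) = B c - (h / h1) * K"
    by (simp add: algebra_simps)
  also have "\<dots> \<le> B c - q * K"
    using h h1 K by (intro diff_left_mono mult_right_mono) (auto simp: field_simps)
  also have "\<dots> = B c - K + \<epsilon>" using K by (simp add: q_def field_simps)
  finally have "B (c - h) \<le> B c - K + \<epsilon>" .
  moreover have "B c \<ge> C"
    using s0 K by (simp add: c_def s) (smt (verit) mult_nonneg_nonneg of_nat_0_le_iff)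
  ultimately show ?thesis using that h up by blast
qed

lemma holomorphic_on_herm:
  assumes "holomorphic_curve f" shows "(\<lambda>t. herm (f t) a) holomorphic_on UNIV"
  using assms unfolding holomorphic_curve_def herm_def by (intro holomorphic_intros) auto

context
  fixes f :: "complex \<Rightarrow> complex ^ 'd::finite"
  assumes hol: "holomorphic_curve f" and nonconst: "\<not> f constant_on UNIV"
begin

lemma circle_max_attained:
  obtains t where "norm t = exp s" "norm (f t) = (SUP t\<in>sphere 0 (exp s). norm (f t))"
    "\<And>u. norm u = exp s \<Longrightarrow> norm (f u) \<le> norm (f t)"
proof -
  have "continuous_on (sphere 0 (exp s)) (\<lambda>t. norm (f t))"
    by (intro continuous_on_norm holomorphic_curve_continuous hol)
  then obtain t where t: "t \<in> sphere 0 (exp s)" "\<And>u. u \<in> sphere 0 (exp s) \<Longrightarrow> norm (f u) \<le> norm (f t)"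
    using continuous_attains_sup[of "sphere 0 (exp s)" "\<lambda>t. norm (f t)"] by auto
  moreover have "norm (f t) = (SUP t\<in>sphere 0 (exp s). norm (f t))"
    using t by (intro cSup_eq_maximum[symmetric]) auto
  ultimately show ?thesis using that by auto
qed

text \<open>
  A nonconstant curve does not vanish identically on a circle, by the identity theorem.
\<close>
lemma circle_max_pos: "(SUP t\<in>sphere 0 (exp s). norm (f t)) > 0"
proof (rule ccontr)
  assume neg: "\<not> ?thesis"
  obtain t where t: "norm t = exp s" "norm (f t) = (SUP t\<in>sphere 0 (exp s). norm (f t))"
    "\<And>u. norm u = exp s \<Longrightarrow> norm (f u) \<le> norm (f t)"
    by (rule circle_max_attained[of s]) auto
  have zero: "f u = 0" if "norm u = exp s" for u
    using t neg that by (metis norm_le_zero_iff not_less order_trans)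
  have "t islimpt sphere 0 (exp s)"
  proof (rule connected_imp_perfect)
    show "sphere 0 (exp s) \<noteq> {x}" for x :: complex
    proof
      assume eq: "sphere 0 (exp s) = {x}"
      have "t \<in> sphere 0 (exp s)" "- t \<in> sphere 0 (exp s)" using t(1) by auto
      then have "t = - t" unfolding eq by simp
      then show False using t(1) by simp
    qed
  qed (use t(1) in \<open>simp_all add: connected_sphere\<close>)
  then have "f u $ i = 0" for u i
    using hol zero unfolding holomorphic_curve_def
    by (intro analytic_continuation[of "\<lambda>t. f t $ i" UNIV "sphere 0 (exp s)" t u]) auto
  then have "f u = 0" for u by (simp add: vec_eq_iff)
  then show False using nonconst by (auto simp: constant_on_def)
qed

lemma log_max_attained:
  obtains w where "Re w = s" "norm (f (exp w)) = exp (log_max f s)"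
proof -
  obtain t where t: "norm t = exp s" "norm (f t) = (SUP t\<in>sphere 0 (exp s). norm (f t))"
    by (rule circle_max_attained[of s])
  have "t \<noteq> 0" using t(1) by auto
  then have "exp (Ln t) = t" "Re (Ln t) = s" using t(1) by auto
  then show ?thesis using that[of "Ln t"] t(2) circle_max_pos[of s] by (simp add: log_max_def)
qed

lemma norm_le_log_max: "norm (f (exp w)) \<le> exp (log_max f (Re w))"
proof -
  obtain t where t: "norm t = exp (Re w)" "norm (f t) = (SUP t\<in>sphere 0 (exp (Re w)). norm (f t))"
    "\<And>u. norm u = exp (Re w) \<Longrightarrow> norm (f u) \<le> norm (f t)"
    by (rule circle_max_attained[of "Re w"]) auto
  then show ?thesis using circle_max_pos[of "Re w"] t(2) t(3)[of "exp w"] by (simp add: log_max_def)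
qed

text \<open>
  Hadamard's three circles theorem for curves. It suffices to bound the scalar function
  \<open>\<langle>f, a\<rangle>\<close> where \<open>a\<close> is the value of \<open>f\<close> at a maximum point on the middle circle, because there
  \<open>\<langle>f, a\<rangle> = \<parallel>f\<parallel> \<parallel>a\<parallel>\<close>, while \<open>\<le>\<close> holds everywhere.
\<close>
lemma convex_on_log_max: "convex_on UNIV (log_max f)"
proof (rule convex_on_linorderI)
  fix t x y :: real assume t: "0 < t" "t < 1" and xy: "x < y"
  define s where "s = (1 - t) *\<^sub>R x + t *\<^sub>R y"
  \<comment> \<open>\<open>N\<close> is the slope of the chord; the factor \<open>exp (- N u)\<close> makes both boundary bounds equal.\<close>
  define N where "N = (log_max f y - log_max f x) / (y - x)"
  have N: "log_max f y = log_max f x + N * (y - x)" using xy by (simp add: N_def)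
  have s: "s = x + t * (y - x)" by (simp add: s_def algebra_simps)
  have "0 \<le> t * (y - x)" "t * (y - x) \<le> y - x"
    using t xy by (auto simp: mult_left_le_one_le)
  then have sxy: "x \<le> s" "s \<le> y" unfolding s by linarith+
  obtain w where w: "Re w = s" "norm (f (exp w)) = exp (log_max f s)" by (rule log_max_attained)
  define a where "a = f (exp w)"
  define g where "g = (\<lambda>u. herm (f (exp u)) a * exp (- of_real N * u))"
  have ng: "norm (g u) = norm (herm (f (exp u)) a) * exp (- N * Re u)" for u
    by (simp add: g_def norm_mult)
  have gle: "norm (g u) \<le> exp (log_max f (Re u) - N * Re u) * norm a" for u
  proof -
    have "norm (herm (f (exp u)) a) \<le> exp (log_max f (Re u)) * norm a"
      by (rule order_trans[OF norm_herm_le]) (intro mult_right_mono norm_le_log_max norm_ge_zero)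
    then show ?thesis unfolding ng
      using mult_right_mono[of "norm (herm (f (exp u)) a)" "exp (log_max f (Re u)) * norm a" "exp (- N * Re u)"]
      by (simp add: exp_diff exp_minus field_simps)
  qed
  have "norm (g w) \<le> exp (log_max f x - N * x) * norm a"
  proof (rule three_lines_periodic[where g = g and w = w and a = x and b = y])
    have "(\<lambda>t. herm (f t) a) \<circ> exp holomorphic_on UNIV"
      by (rule holomorphic_on_compose_gen[OF _ holomorphic_on_herm[OF hol]]) (auto intro: holomorphic_intros)
    then show "g holomorphic_on UNIV"
      unfolding g_def by (intro holomorphic_intros) (simp add: o_def)
    show "norm (g (u + 2 * of_real pi * \<i>)) = norm (g u)" for u
      unfolding ng by (simp add: exp_add)
    show "norm (g u) \<le> exp (log_max f x - N * x) * norm a" if "Re u = x" for u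
      using gle[of u] that by simp
    show "norm (g u) \<le> exp (log_max f x - N * x) * norm a" if "Re u = y" for u
      using gle[of u] that by (simp add: N algebra_simps)
  qed (use sxy w in auto)
  moreover have "norm (g w) = exp (log_max f s - N * s) * norm a"
    unfolding ng using w by (simp add: a_def[symmetric] norm_herm_self exp_diff exp_minus field_simps)
  moreover have "norm a > 0" using w by (simp add: a_def)
  ultimately have "log_max f s - N * s \<le> log_max f x - N * x" by simp
  then have "log_max f s \<le> log_max f x + t * (N * (y - x))" by (simp add: s algebra_simps)
  also have "\<dots> = (1 - t) * log_max f x + t * log_max f y" by (simp add: N algebra_simps)
  finally show "log_max f ((1 - t) *\<^sub>R x + t *\<^sub>R y) \<le> (1 - t) * log_max f x + t * log_max f y"
    by (simp add: s_def)
qed auto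

lemma mono_log_max: "mono (log_max f)"
proof (rule monoI)
  fix x y :: real assume xy: "x \<le> y"
  obtain w where w: "Re w = x" "norm (f (exp w)) = exp (log_max f x)" by (rule log_max_attained)
  define a where "a = f (exp w)"
  have hol_a: "(\<lambda>t. herm (f t) a) holomorphic_on UNIV" by (rule holomorphic_on_herm[OF hol])
  have "norm (herm (f (exp w)) a) \<le> exp (log_max f y) * norm a"
  proof (rule maximum_modulus_frontier[where f = "\<lambda>t. herm (f t) a" and S = "cball 0 (exp y)"])
    show "(\<lambda>t. herm (f t) a) holomorphic_on interior (cball 0 (exp y))"
      using hol_a by (rule holomorphic_on_subset) auto
    show "continuous_on (closure (cball 0 (exp y))) (\<lambda>t. herm (f t) a)"
      using hol_a by (meson holomorphic_on_imp_continuous_on holomorphic_on_subset subset_UNIV)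
    fix z :: complex assume "z \<in> frontier (cball 0 (exp y))"
    then have z: "norm z = exp y" by simp
    then have "z \<noteq> 0" by auto
    then have "exp (Ln z) = z" "Re (Ln z) = y" using z by auto
    then have "norm (f z) \<le> exp (log_max f y)" using norm_le_log_max[of "Ln z"] by simp
    then show "norm (herm (f z) a) \<le> exp (log_max f y) * norm a"
      by (meson mult_right_mono norm_ge_zero norm_herm_le order_trans)
  qed (use xy w in auto)
  moreover have "norm (herm (f (exp w)) a) = exp (log_max f x) * norm a"
    using w by (simp add: a_def[symmetric] norm_herm_self)
  moreover have "norm a > 0" using w by (simp add: a_def)
  ultimately show "log_max f x \<le> log_max f y" by simp
qed

lemma log_max_unbounded: "\<exists>s. log_max f s > C"
proof (rule ccontr)
  assume "\<not> ?thesis"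
  then have C: "log_max f s \<le> C" for s by (meson not_less)
  have le: "norm (f t) \<le> max (exp C) (norm (f 0))" for t
  proof (cases "t = 0")
    case False
    then have "norm (f t) \<le> exp (log_max f (Re (Ln t)))"
      using norm_le_log_max[of "Ln t"] by simp
    also have "\<dots> \<le> exp C" using C by simp
    finally show ?thesis by simp
  qed simp
  have "(\<lambda>t. f t $ i) constant_on UNIV" for i
  proof (rule Liouville_theorem)
    show "(\<lambda>t. f t $ i) holomorphic_on UNIV" using hol by (simp add: holomorphic_curve_def)
    show "bounded (range (\<lambda>t. f t $ i))"
      unfolding bounded_iff using le by (blast intro: order_trans Finite_Cartesian_Product.norm_nth_le)
  qed
  then have "f t $ i = f 0 $ i" for t i unfolding constant_on_def by (metis UNIV_I)
  then have "f t = f 0" for t by (simp add: vec_eq_iff)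
  then show False using nonconst by (auto simp: constant_on_def)
qed

end

text \<open>
  The Schwarz-Pick inequality for \<open>\<phi> / L\<close>: a holomorphic function whose modulus at the centre of a
  disc is almost its supremum is almost constant on the concentric disc of half the radius.
\<close>
lemma near_maximum_nearly_constant:
  fixes \<phi> :: "complex \<Rightarrow> complex"
  assumes hol: "\<phi> holomorphic_on ball 0 K" and K: "K > 0" and L: "L > 1"
    and bound: "\<And>z. norm z < K \<Longrightarrow> norm (\<phi> z) < L" and one: "\<phi> 0 = 1"
    and z: "norm z \<le> K / 2"
  shows "norm (\<phi> z - 1) \<le> L - 1 / L"
proof -
  define a where "a = 1 / L"
  have a: "0 < a" "a < 1" "a * L = 1" using L by (auto simp: a_def)
  define h where "h = (\<lambda>w. of_real a * \<phi> (of_real K * w))"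
  have inball: "norm (of_real K * w) < K" if "norm w < 1" for w :: complex
    using that K by (simp add: norm_mult)
  have h_lt: "norm (h w) < 1" if "norm w < 1" for w
  proof -
    have "a * norm (\<phi> (of_real K * w)) < a * L"
      using bound[OF inball[OF that]] a by (intro mult_strict_left_mono)
    then show ?thesis using a by (simp add: h_def norm_mult)
  qed
  have hol_h: "h holomorphic_on ball 0 1"
  proof -
    have "\<phi> \<circ> (\<lambda>w. of_real K * w) holomorphic_on ball 0 1"
      by (rule holomorphic_on_compose_gen[OF _ hol]) (use inball in \<open>auto intro!: holomorphic_intros\<close>)
    then show ?thesis unfolding h_def o_def by (intro holomorphic_intros)
  qed
  \<comment> \<open>The Moebius transformation that moves \<open>h 0 = a\<close> to \<open>0\<close> prepares for the Schwarz lemma.\<close>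
  define \<psi> where "\<psi> = (\<lambda>w. (h w - of_real a) / (1 - of_real a * h w))"
  have ah: "norm (of_real a * h w) < 1" if "norm w < 1" for w
    using h_lt[OF that] a by (simp add: norm_mult) (smt (verit) mult_less_cancel_left2 mult_nonneg_nonneg norm_ge_zero mult_le_cancel_right1)
  then have nz: "1 - of_real a * h w \<noteq> 0" if "norm w < 1" for w
    using that by fastforce
  have z1: "norm (z / of_real K) < 1" "norm (z / of_real K) \<le> 1/2"
    using z K by (auto simp: norm_divide field_simps)
  have "norm (\<psi> (z / of_real K)) \<le> norm (z / of_real K)"
  proof (rule Schwarz_Lemma(1))
    show "\<psi> holomorphic_on ball 0 1"
      unfolding \<psi>_def using nz by (intro holomorphic_intros hol_h) auto
    show "\<psi> 0 = 0" by (simp add: \<psi>_def h_def one)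
    show "norm (\<psi> w) < 1" if "norm w < 1" for w
    proof -
      have "(norm (1 - of_real a * h w))\<^sup>2 - (norm (h w - of_real a))\<^sup>2
          = (1 - a\<^sup>2) * (1 - (norm (h w))\<^sup>2)"
        unfolding cmod_power2 by (simp add: power2_eq_square algebra_simps)
      moreover have "0 < (1 - a\<^sup>2) * (1 - (norm (h w))\<^sup>2)"
        using a h_lt[OF that] by (intro mult_pos_pos) (auto simp: abs_square_less_1)
      ultimately have "(norm (h w - of_real a))\<^sup>2 < (norm (1 - of_real a * h w))\<^sup>2" by linarith
      then have "norm (h w - of_real a) < norm (1 - of_real a * h w)"
        by (rule power2_less_imp_less) simp
      then show ?thesis using nz[OF that] by (simp add: \<psi>_def norm_divide field_simps)
    qed
  qed (use z1 in auto)
  then have "norm (h (z / of_real K) - of_real a) / norm (1 - of_real a * h (z / of_real K)) \<le> 1/2"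
    using z1(2) unfolding \<psi>_def norm_divide by linarith
  then have 1: "norm (h (z / of_real K) - of_real a) \<le> norm (1 - of_real a * h (z / of_real K)) / 2"
    using nz[OF z1(1)] by (simp add: field_simps)
  have "1 - of_real a * h (z / of_real K) = of_real (1 - a\<^sup>2) - of_real a * (h (z / of_real K) - of_real a)"
    by (simp add: algebra_simps power2_eq_square)
  also have "norm \<dots> \<le> (1 - a\<^sup>2) + a * norm (h (z / of_real K) - of_real a)"
    using a by (intro order_trans[OF norm_triangle_ineq4]) (auto simp: norm_mult power_le_one simp del: of_real_diff)
  also have "\<dots> \<le> (1 - a\<^sup>2) + 1 * norm (h (z / of_real K) - of_real a)"
    using a by (intro add_left_mono mult_right_mono) auto
  finally have 2: "norm (h (z / of_real K) - of_real a) \<le> 1 - a\<^sup>2" using 1 by linarith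
  have "\<phi> z - 1 = of_real L * (h (z / of_real K) - of_real a)"
    using K a L by (simp add: h_def a_def field_simps)
  then have "norm (\<phi> z - 1) = L * norm (h (z / of_real K) - of_real a)" using L by (simp add: norm_mult)
  also have "\<dots> \<le> L * (1 - a\<^sup>2)" using 2 L by (intro mult_left_mono) auto
  also have "\<dots> = L - 1 / L" using L by (simp add: a_def field_simps power2_eq_square)
  finally show ?thesis .
qed

text \<open>
  By \<open>growth_scale\<close> there are a maximum point \<open>exp c\<close> of \<open>\<parallel>f\<parallel>\<close> on its circle and a scale \<open>\<kappa>\<close> for which
  \<open>H \<tau> = exp (- \<tau>) \<cdot> f (exp (c + \<kappa> \<tau>))\<close> satisfies \<open>\<parallel>H \<tau>\<parallel> \<le> L \<parallel>H 0\<parallel>\<close> on a large disc, with \<open>L\<close> close to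
  \<open>1\<close>. So \<open>\<langle>H, H 0\<rangle>\<close> almost attains its maximum modulus at \<open>0\<close> and is almost constant. As the norm
  is Euclidean, this forces all components of \<open>H\<close> to be almost constant, also those in which \<open>H 0\<close> is small.
\<close>
lemma wiman_valiron:
  fixes f :: "complex \<Rightarrow> complex ^ 'd::finite"
  assumes hol: "holomorphic_curve f" and nonconst: "\<not> f constant_on UNIV"
    and R: "R > 0" and \<delta>: "\<delta> > 0"
  obtains c \<kappa> where "norm (f (exp c)) \<ge> C"
    "\<And>\<tau>. norm \<tau> \<le> R \<Longrightarrow>
       norm (f (exp (c + of_real \<kappa> * \<tau>)) - exp \<tau> *s f (exp c)) \<le> \<delta> * norm (f (exp c))"
proof -
  define K where "K = 2 * R"
  have K: "K > 0" using R by (simp add: K_def)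
  \<comment> \<open>The left-hand side of \<open>Lsmall\<close> is the bound for \<open>\<parallel>H \<tau> - H 0\<parallel>\<^sup>2 / \<parallel>H 0\<parallel>\<^sup>2\<close> found at the end of
    the proof; the factor \<open>exp R\<close> absorbs the return from \<open>H\<close> to \<open>f\<close>.\<close>
  obtain L where L: "L > 1" and Lsmall: "L\<^sup>2 - 1 + 2 * (L - 1 / L) \<le> (\<delta> / exp R)\<^sup>2"
  proof -
    have "((\<lambda>L::real. L\<^sup>2 - 1 + 2 * (L - 1 / L)) \<longlongrightarrow> 1\<^sup>2 - 1 + 2 * (1 - 1 / 1)) (at_right 1)"
      by (intro tendsto_intros) auto
    then have "\<forall>\<^sub>F L in at_right (1::real). L\<^sup>2 - 1 + 2 * (L - 1 / L) < (\<delta> / exp R)\<^sup>2"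
      using \<delta> by (intro order_tendstoD(2)) auto
    moreover have "\<forall>\<^sub>F L in at_right (1::real). L > 1" by (simp add: eventually_at_right_less)
    ultimately have "\<forall>\<^sub>F L in at_right (1::real). L > 1 \<and> L\<^sup>2 - 1 + 2 * (L - 1 / L) < (\<delta> / exp R)\<^sup>2"
      by eventually_elim auto
    then obtain L :: real where "L > 1 \<and> L\<^sup>2 - 1 + 2 * (L - 1 / L) < (\<delta> / exp R)\<^sup>2"
      using eventually_happens'[OF trivial_limit_at_right_real] by blast
    then show ?thesis by (intro that[of L]) auto
  qed
  define \<epsilon> where "\<epsilon> = min (ln L / 2) (K / 2)"
  have \<epsilon>: "0 < \<epsilon>" "\<epsilon> < K" "\<epsilon> < ln L" using L K by (auto simp: \<epsilon>_def min_def ln_gt_zero)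
  obtain c0 h where h: "h > 0" "log_max f c0 \<ge> ln (max C 1)"
    "log_max f (c0 + h) \<le> log_max f c0 + K" "log_max f (c0 - h) \<le> log_max f c0 - K + \<epsilon>"
    by (rule growth_scale[OF convex_on_log_max[OF hol nonconst] mono_log_max[OF hol nonconst]
          log_max_unbounded[OF hol nonconst] K \<epsilon>(1,2)])
  define \<kappa> where "\<kappa> = h / K"
  obtain c where c: "Re c = c0" "norm (f (exp c)) = exp (log_max f c0)"
    by (rule log_max_attained[OF hol nonconst])
  define a where "a = f (exp c)"
  have a: "norm a = exp (log_max f c0)" "norm a > 0" using c by (auto simp: a_def)
  have aC: "norm a \<ge> C"
  proof -
    have "C \<le> exp (ln (max C 1))" by simp
    also have "\<dots> \<le> norm a" using h(2) unfolding a(1) exp_le_cancel_iff .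
    finally show ?thesis .
  qed
  have B: "log_max f (c0 + \<kappa> * \<sigma>) \<le> log_max f c0 + \<sigma> + \<epsilon>" if \<sigma>: "\<bar>\<sigma>\<bar> \<le> K" for \<sigma>
  proof -
    have conv: "log_max f (c0 + u * e) \<le> (1 - u) * log_max f c0 + u * log_max f (c0 + e)"
      if "0 \<le> u" "u \<le> 1" for u e
      using convex_onD[OF convex_on_log_max[OF hol nonconst], of u c0 "c0 + e"] that
      by (simp add: algebra_simps)
    show ?thesis
    proof (cases "\<sigma> \<ge> 0")
      case True
      have u: "0 \<le> \<sigma> / K" "\<sigma> / K \<le> 1" using True \<sigma> K by auto
      have "log_max f (c0 + \<kappa> * \<sigma>) \<le> (1 - \<sigma> / K) * log_max f c0 + \<sigma> / K * log_max f (c0 + h)"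
        using conv[OF u, of h] by (simp add: \<kappa>_def mult.commute)
      also have "\<dots> \<le> (1 - \<sigma> / K) * log_max f c0 + \<sigma> / K * (log_max f c0 + K)"
        using u h by (intro add_left_mono mult_left_mono) auto
      also have "\<dots> = log_max f c0 + \<sigma>" using K by (simp add: field_simps)
      finally show ?thesis using \<epsilon> by simp
    next
      case False
      define u where "u = - \<sigma> / K"
      have u: "0 \<le> u" "u \<le> 1" using False \<sigma> K by (auto simp: u_def field_simps)
      have "log_max f (c0 + \<kappa> * \<sigma>) \<le> (1 - u) * log_max f c0 + u * log_max f (c0 - h)"
        using conv[OF u, of "- h"] by (simp add: \<kappa>_def u_def mult.commute)
      also have "\<dots> \<le> (1 - u) * log_max f c0 + u * (log_max f c0 - K + \<epsilon>)"
        using u h by (intro add_left_mono mult_left_mono) auto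
      also have "\<dots> = log_max f c0 - u * K + u * \<epsilon>" by (simp add: algebra_simps)
      also have "u * K = - \<sigma>" using K by (simp add: u_def)
      also have "u * \<epsilon> \<le> \<epsilon>" using u \<epsilon> by (simp add: mult_left_le_one_le)
      finally show ?thesis by simp
    qed
  qed
  define F where "F = (\<lambda>\<tau>. f (exp (c + of_real \<kappa> * \<tau>)))"
  define H where "H = (\<lambda>\<tau>. exp (- \<tau>) *s F \<tau>)"
  have norm_smult: "norm (z *s (v :: complex ^ 'd)) = norm z * norm v" for z v
  proof -
    have "norm (z *s v) = L2_set (\<lambda>i. norm z * norm (v $ i)) UNIV"
      by (simp add: norm_vec_def norm_mult)
    then show ?thesis by (simp add: norm_vec_def L2_set_right_distrib)
  qed
  have H_lt: "norm (H \<tau>) < L * norm a" if "norm \<tau> < K" for \<tau>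
  proof -
    have "\<bar>Re \<tau>\<bar> \<le> K" using abs_Re_le_cmod[of \<tau>] that by linarith
    have "norm (F \<tau>) \<le> exp (log_max f (c0 + \<kappa> * Re \<tau>))"
      using norm_le_log_max[OF hol nonconst, of "c + of_real \<kappa> * \<tau>"] c by (simp add: F_def)
    also have "\<dots> \<le> exp (log_max f c0 + Re \<tau> + \<epsilon>)" using B[OF \<open>\<bar>Re \<tau>\<bar> \<le> K\<close>] by simp
    finally have "norm (F \<tau>) \<le> norm a * exp (Re \<tau>) * exp \<epsilon>" by (simp add: exp_add a)
    moreover have "norm (H \<tau>) = exp (- Re \<tau>) * norm (F \<tau>)" by (simp add: H_def norm_smult)
    ultimately have "norm (H \<tau>) \<le> exp (- Re \<tau>) * (norm a * exp (Re \<tau>) * exp \<epsilon>)"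
      by simp
    also have "\<dots> = norm a * exp \<epsilon>" by (simp add: exp_minus)
    finally have "norm (H \<tau>) \<le> norm a * exp \<epsilon>" .
    also have "\<dots> < norm a * exp (ln L)" using a \<epsilon> by (intro mult_strict_left_mono) auto
    finally show ?thesis using L by (simp add: mult.commute)
  qed
  have H0: "H 0 = a" by (simp add: H_def F_def a_def)
  define \<phi> where "\<phi> = (\<lambda>\<tau>. herm (H \<tau>) a / of_real ((norm a)\<^sup>2))"
  have phi: "norm (\<phi> \<tau> - 1) \<le> L - 1 / L" if \<tau>: "norm \<tau> \<le> R" for \<tau>
  proof (rule near_maximum_nearly_constant[where \<phi> = \<phi> and z = \<tau>, OF _ K L])
    have "(\<lambda>t. herm (f t) a) \<circ> (\<lambda>\<tau>. exp (c + of_real \<kappa> * \<tau>)) holomorphic_on ball 0 K"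
      by (rule holomorphic_on_compose_gen[OF _ holomorphic_on_herm[OF hol]]) (auto intro!: holomorphic_intros)
    then show "\<phi> holomorphic_on ball 0 K"
      unfolding \<phi>_def H_def herm_scale F_def o_def using a
      by (intro holomorphic_intros) auto
    show "norm (\<phi> z) < L" if "norm z < K" for z
    proof -
      have "norm (herm (H z) a) \<le> norm (H z) * norm a" by (rule norm_herm_le)
      also have "\<dots> < L * norm a * norm a" using H_lt[OF that] a by (intro mult_strict_right_mono) auto
      finally show ?thesis using a by (simp add: \<phi>_def norm_divide field_simps power2_eq_square norm_mult)
    qed
    show "\<phi> 0 = 1" using a by (simp add: \<phi>_def H0 herm_self)
    show "norm \<tau> \<le> K / 2" using \<tau> by (simp add: K_def)
  qed
  have near: "norm (F \<tau> - exp \<tau> *s a) \<le> \<delta> * norm a" if \<tau>: "norm \<tau> \<le> R" for \<tau>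
  proof -
    have "norm \<tau> < K" using \<tau> R by (simp add: K_def)
    have "1 - Re (\<phi> \<tau>) \<le> L - 1 / L"
      using phi[OF \<tau>] abs_Re_le_cmod[of "\<phi> \<tau> - 1"] by simp
    moreover have "Re (\<phi> \<tau>) = (H \<tau> \<bullet> a) / (norm a)\<^sup>2"
      unfolding \<phi>_def Re_divide_of_real Re_herm ..
    ultimately have inner: "(1 - (L - 1 / L)) * (norm a)\<^sup>2 \<le> H \<tau> \<bullet> a"
      using a by (simp add: field_simps)
    have "(norm (H \<tau> - a))\<^sup>2 = (norm (H \<tau>))\<^sup>2 + (norm a)\<^sup>2 - 2 * (H \<tau> \<bullet> a)"
      by (simp add: power2_norm_eq_inner inner_diff inner_commute)
    also have "\<dots> \<le> (L * norm a)\<^sup>2 + (norm a)\<^sup>2 - 2 * ((1 - (L - 1 / L)) * (norm a)\<^sup>2)"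
      using inner H_lt[OF \<open>norm \<tau> < K\<close>] by (intro diff_mono add_right_mono power_mono) auto
    also have "\<dots> = (L\<^sup>2 - 1 + 2 * (L - 1 / L)) * (norm a)\<^sup>2" by (simp add: algebra_simps power2_eq_square)
    also have "\<dots> \<le> (\<delta> / exp R)\<^sup>2 * (norm a)\<^sup>2" using Lsmall by (intro mult_right_mono) auto
    finally have "(norm (H \<tau> - a))\<^sup>2 \<le> (\<delta> / exp R * norm a)\<^sup>2"
      unfolding power_mult_distrib .
    then have "norm (H \<tau> - a) \<le> \<delta> / exp R * norm a"
      by (rule power2_le_imp_le) (use \<delta> a in simp)
    moreover have "F \<tau> - exp \<tau> *s a = exp \<tau> *s (H \<tau> - a)"
      by (simp add: H_def vec_eq_iff exp_minus algebra_simps)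
    ultimately have "norm (F \<tau> - exp \<tau> *s a) \<le> exp (Re \<tau>) * (\<delta> / exp R * norm a)"
      by (metis norm_smult norm_exp_eq_Re mult_left_mono exp_ge_zero)
    also have "\<dots> \<le> exp R * (\<delta> / exp R * norm a)"
      using \<tau> complex_Re_le_cmod[of \<tau>] \<delta> by (intro mult_right_mono) auto
    finally show ?thesis by simp
  qed
  show ?thesis
    using that[of c] near aC unfolding F_def a_def by blast
qed

section \<open>Exponents of strictly largest real part\<close>

text \<open>
  The number of phases of a coordinate exceeds the total number of phases of all coordinates
  with smaller labels. A coordinate with label \<open>0\<close> has the single phase \<open>1\<close>.
\<close>
definition phases :: "('i \<Rightarrow> nat) \<Rightarrow> 'i \<Rightarrow> complex set" where
  "phases e i = {\<omega>. \<omega> ^ (2 ^ e i) = 1}"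

lemma finite_phases [simp]: "finite (phases e i)"
  unfolding phases_def by (rule finite_roots_unity) (simp add: Suc_leI)

lemma card_phases: "card (phases e i) = 2 ^ e i"
  unfolding phases_def by (rule card_roots_unity_eq) simp

lemma norm_phase: "\<omega> \<in> phases e i \<Longrightarrow> norm \<omega> = 1"
  unfolding phases_def by (auto dest: power_eq_1_iff[rotated])

text \<open>
  Among the coordinates whose modulus has the maximal value \<open>r\<close>, let \<open>i\<close> be the one with the largest label.
  The points \<open>\<omega> \<cdot> v\<^sub>i\<close> on the circle of radius \<open>r\<close> outnumber the points contributed
  by the other coordinates of modulus \<open>r\<close>, so one of them is contributed by \<open>(i, \<omega>)\<close> only. Rotated to
  the positive real axis, it has strictly the largest real part, because all other points lie in the closed
  disc of radius \<open>r\<close> and differ from it.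
\<close>
lemma untied_exponent:
  fixes e :: "'i::finite \<Rightarrow> nat" and v :: "complex ^ 'i"
  assumes e: "inj e" and v: "v \<noteq> 0"
  obtains \<kappa> i \<omega> where "norm \<kappa> = 1" "\<omega> \<in> phases e i" "0 < Re (\<kappa> * \<omega> * v $ i)"
    "\<And>j \<eta>. \<eta> \<in> phases e j \<Longrightarrow> (j, \<eta>) \<noteq> (i, \<omega>) \<Longrightarrow> Re (\<kappa> * \<eta> * v $ j) < Re (\<kappa> * \<omega> * v $ i)"
proof -
  define r where "r = Max (range (\<lambda>i. norm (v $ i)))"
  have le_r: "norm (v $ i) \<le> r" for i unfolding r_def by (rule Max_ge) auto
  obtain i0 where "v $ i0 \<noteq> 0" using v by (auto simp: vec_eq_iff)
  then have r: "r > 0" using le_r[of i0] by (simp add: order_less_le_trans[of 0 "norm (v $ i0)"])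
  define I where "I = {i. norm (v $ i) = r}"
  have "r \<in> range (\<lambda>i. norm (v $ i))" unfolding r_def by (rule Max_in) auto
  then have "I \<noteq> {}" by (auto simp: I_def)
  then have "Max (e ` I) \<in> e ` I" by (intro Max_in) auto
  then obtain i where "i \<in> I" "e i = Max (e ` I)" by auto
  then have i: "i \<in> I" "\<And>j. j \<in> I \<Longrightarrow> e j \<le> e i" by auto
  have vi: "norm (v $ i) = r" "v $ i \<noteq> 0" using i r by (auto simp: I_def)
  define A where "A = (\<Union>j\<in>I - {i}. (\<lambda>\<eta>. \<eta> * v $ j) ` phases e j)"
  have "card A \<le> (\<Sum>j\<in>I - {i}. card ((\<lambda>\<eta>. \<eta> * v $ j) ` phases e j))"
    unfolding A_def by (rule card_UN_le) simp
  also have "\<dots> \<le> (\<Sum>j\<in>I - {i}. 2 ^ e j)"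
    by (intro sum_mono order_trans[OF card_image_le]) (auto simp: card_phases)
  also have "\<dots> = (\<Sum>k\<in>e ` (I - {i}). 2 ^ k)"
    using e by (subst sum.reindex) (auto simp: inj_on_def)
  also have "\<dots> \<le> (\<Sum>k<e i. 2 ^ k)"
  proof (rule sum_mono2)
    show "e ` (I - {i}) \<subseteq> {..<e i}"
      using i(2) injD[OF e] by (auto simp: order_less_le)
  qed auto
  also have "\<dots> < 2 ^ e i" by (simp add: mask_eq_sum_exp_nat[symmetric] lessThan_def)
  also have "\<dots> = card ((\<lambda>\<omega>. \<omega> * v $ i) ` phases e i)"
    using vi by (subst card_image) (auto simp: inj_on_def card_phases)
  finally have "\<not> (\<lambda>\<omega>. \<omega> * v $ i) ` phases e i \<subseteq> A"
    using card_mono[of A "(\<lambda>\<omega>. \<omega> * v $ i) ` phases e i"] by (auto simp: A_def)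
  then obtain \<omega> where \<omega>: "\<omega> \<in> phases e i" "\<omega> * v $ i \<notin> A" by auto
  have no: "norm (\<omega> * v $ i) = r" using \<omega> vi by (simp add: norm_mult norm_phase)
  define \<kappa> where "\<kappa> = cnj (\<omega> * v $ i) / of_real r"
  have \<kappa>: "norm \<kappa> = 1" unfolding \<kappa>_def norm_divide complex_mod_cnj no using r by simp
  have "\<kappa> * (\<omega> * v $ i) = of_real r"
  proof -
    have "\<kappa> * (\<omega> * v $ i) = ((\<omega> * v $ i) * cnj (\<omega> * v $ i)) / of_real r" by (simp add: \<kappa>_def)
    also have "\<dots> = of_real r"
      unfolding complex_norm_square[symmetric] no using r by (simp add: power2_eq_square)
    finally show ?thesis .
  qed
  then have top: "\<kappa> * \<omega> * v $ i = of_real r" by (simp add: mult.assoc)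
  have "Re (\<kappa> * \<eta> * v $ j) < r" if \<eta>: "\<eta> \<in> phases e j" and ne: "(j, \<eta>) \<noteq> (i, \<omega>)" for j \<eta>
  proof -
    have norm: "norm (\<kappa> * \<eta> * v $ j) = norm (v $ j)" using \<kappa> \<eta> by (simp add: norm_mult norm_phase)
    have "\<eta> * v $ j \<noteq> \<omega> * v $ i"
    proof
      assume eq: "\<eta> * v $ j = \<omega> * v $ i"
      then have "norm (v $ j) = r" using no \<eta> by (metis mult_1 norm_mult norm_phase)
      then have "j \<in> I" by (simp add: I_def)
      show False
      proof (cases "j = i")
        case True
        then show False using eq ne vi by simp
      next
        case False
        then have "\<eta> * v $ j \<in> A" using \<open>j \<in> I\<close> \<eta> unfolding A_def by blast
        then show False using eq \<omega>(2) by simp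
      qed
    qed
    then have "\<kappa> * (\<eta> * v $ j) \<noteq> \<kappa> * (\<omega> * v $ i)" using \<kappa> by auto
    then have neq: "\<kappa> * \<eta> * v $ j \<noteq> of_real r" using top by (metis mult.assoc)
    have le: "norm (\<kappa> * \<eta> * v $ j) \<le> r" using norm le_r by simp
    show ?thesis
    proof (rule ccontr)
      assume "\<not> ?thesis"
      then have Re: "Re (\<kappa> * \<eta> * v $ j) = r"
        using le complex_Re_le_cmod[of "\<kappa> * \<eta> * v $ j"] by linarith
      then have "(Im (\<kappa> * \<eta> * v $ j))\<^sup>2 \<le> 0"
        using power_mono[OF le norm_ge_zero, of 2] by (simp only: cmod_power2)
      then have "Im (\<kappa> * \<eta> * v $ j) = 0" by simp
      then show False using neq Re complex_eqI[of "\<kappa> * \<eta> * v $ j" "of_real r"] by simp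
    qed
  qed
  then show ?thesis using that[OF \<kappa> \<omega>(1)] r unfolding top by simp
qed

text \<open>
  Compactness of the unit sphere: the strict inequalities of \<open>untied_exponent\<close> for a limit point \<open>l\<close>
  persist, with half the margin, for all vectors close to \<open>l\<close>.
\<close>
lemma uniformly_untied_exponent:
  fixes e :: "'i::finite \<Rightarrow> nat"
  assumes e: "inj e"
  obtains \<gamma> where "\<gamma> > 0" "\<And>v :: complex ^ 'i. norm v = 1 \<Longrightarrow>
    \<exists>\<kappa> i \<omega>. norm \<kappa> = 1 \<and> \<omega> \<in> phases e i \<and> \<gamma> \<le> Re (\<kappa> * \<omega> * v $ i) \<and>
      (\<forall>j \<eta>. \<eta> \<in> phases e j \<longrightarrow> (j, \<eta>) \<noteq> (i, \<omega>) \<longrightarrow>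
         Re (\<kappa> * \<eta> * v $ j) + \<gamma> \<le> Re (\<kappa> * \<omega> * v $ i))"
proof -
  define P where "P = (\<lambda>\<gamma> (v :: complex ^ 'i). \<exists>\<kappa> i \<omega>. norm \<kappa> = 1 \<and> \<omega> \<in> phases e i \<and>
      \<gamma> \<le> Re (\<kappa> * \<omega> * v $ i) \<and>
      (\<forall>j \<eta>. \<eta> \<in> phases e j \<longrightarrow> (j, \<eta>) \<noteq> (i, \<omega>) \<longrightarrow>
         Re (\<kappa> * \<eta> * v $ j) + \<gamma> \<le> Re (\<kappa> * \<omega> * v $ i)))"
  have "\<exists>\<gamma>>0. \<forall>v. norm v = 1 \<longrightarrow> P \<gamma> v"
  proof (rule ccontr)
    assume "\<not> ?thesis"
    then have "\<exists>v. norm v = 1 \<and> \<not> P (1 / (real k + 1)) v" for k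
      by (meson of_nat_0_le_iff zero_less_divide_1_iff add_nonneg_pos zero_less_one)
    then obtain v where v: "\<And>k. norm (v k) = 1" "\<And>k. \<not> P (1 / (real k + 1)) (v k)" by metis
    have "seq_compact (sphere (0 :: complex ^ 'i) 1)"
      by (rule compact_imp_seq_compact) (rule compact_sphere)
    moreover have "\<forall>k. v k \<in> sphere 0 1" using v by simp
    ultimately obtain l s where l: "l \<in> sphere 0 1" and s: "strict_mono s" "(v \<circ> s) \<longlonglongrightarrow> l"
      unfolding seq_compact_def by metis
    have "l \<noteq> 0" using l by auto
    then obtain \<kappa> i \<omega> where top: "norm \<kappa> = 1" "\<omega> \<in> phases e i" "0 < Re (\<kappa> * \<omega> * l $ i)"
      "\<And>j \<eta>. \<eta> \<in> phases e j \<Longrightarrow> (j, \<eta>) \<noteq> (i, \<omega>) \<Longrightarrow> Re (\<kappa> * \<eta> * l $ j) < Re (\<kappa> * \<omega> * l $ i)"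
      by (rule untied_exponent[OF e]) blast
    define T where "T = Sigma UNIV (phases e) - {(i, \<omega>)}"
    define G where "G = insert (Re (\<kappa> * \<omega> * l $ i))
      ((\<lambda>p. Re (\<kappa> * \<omega> * l $ i) - Re (\<kappa> * snd p * l $ fst p)) ` T)"
    have fin: "finite G" by (simp add: G_def T_def)
    define g where "g = Min G"
    have "0 < x" if "x \<in> G" for x
      using that unfolding G_def
    proof (elim insertE imageE)
      fix p assume p: "p \<in> T" "x = Re (\<kappa> * \<omega> * l $ i) - Re (\<kappa> * snd p * l $ fst p)"
      then have "snd p \<in> phases e (fst p)" "(fst p, snd p) \<noteq> (i, \<omega>)" by (auto simp: T_def)
      then show "0 < x" unfolding p(2) using top(4) by (simp only: diff_gt_0_iff_gt)
    qed (use top(3) in simp)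
    then have g: "g > 0" using fin unfolding g_def by (subst Min_gr_iff) (auto simp: G_def)
    have g1: "g \<le> Re (\<kappa> * \<omega> * l $ i)" using fin unfolding g_def by (intro Min_le) (auto simp: G_def)
    have g2: "g \<le> Re (\<kappa> * \<omega> * l $ i) - Re (\<kappa> * \<eta> * l $ j)"
      if "\<eta> \<in> phases e j" "(j, \<eta>) \<noteq> (i, \<omega>)" for j \<eta>
      unfolding g_def
    proof (rule Min_le[OF fin])
      have "(j, \<eta>) \<in> T" using that by (simp add: T_def)
      then show "Re (\<kappa> * \<omega> * l $ i) - Re (\<kappa> * \<eta> * l $ j) \<in> G"
        unfolding G_def by (intro insertI2 rev_image_eqI[of "(j, \<eta>)"]) simp_all
    qed
    have "\<forall>\<^sub>F k in sequentially. dist ((v \<circ> s) k) l < g / 4"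
      by (rule tendstoD[OF s(2)]) (use g in simp)
    moreover have "\<forall>\<^sub>F k in sequentially. 1 / (real k + 1) < g / 4"
      using lim_const_over_succ[of 1] g by (intro order_tendstoD(2)) auto
    ultimately have "\<forall>\<^sub>F k in sequentially. dist ((v \<circ> s) k) l < g / 4 \<and> 1 / (real k + 1) < g / 4"
      by eventually_elim auto
    then obtain k where k: "dist (v (s k)) l < g / 4" "1 / (real k + 1) < g / 4"
      by (auto dest: eventually_happens)
    have "1 / (real (s k) + 1) \<le> 1 / (real k + 1)"
      using seq_suble[OF s(1), of k] by (simp add: frac_le)
    then have small: "1 / (real (s k) + 1) < g / 4" using k by linarith
    have diff: "\<bar>Re (\<kappa> * \<eta> * v (s k) $ j) - Re (\<kappa> * \<eta> * l $ j)\<bar> \<le> g / 4"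
      if "\<eta> \<in> phases e j" for j \<eta>
    proof -
      have "\<bar>Re (\<kappa> * \<eta> * v (s k) $ j) - Re (\<kappa> * \<eta> * l $ j)\<bar>
          = \<bar>Re (\<kappa> * \<eta> * (v (s k) - l) $ j)\<bar>"
        by (simp add: algebra_simps)
      also have "\<dots> \<le> norm (\<kappa> * \<eta> * (v (s k) - l) $ j)" by (rule abs_Re_le_cmod)
      also have "\<dots> = norm ((v (s k) - l) $ j)" using top(1) norm_phase[OF that] by (simp add: norm_mult)
      also have "\<dots> \<le> norm (v (s k) - l)" by (rule Finite_Cartesian_Product.norm_nth_le)
      finally show ?thesis using k by (simp add: dist_norm)
    qed
    have "P (1 / (real (s k) + 1)) (v (s k))"
      unfolding P_def
    proof (intro exI conjI allI impI)
      show "1 / (real (s k) + 1) \<le> Re (\<kappa> * \<omega> * v (s k) $ i)"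
        using diff[OF top(2)] g1 small by linarith
      show "Re (\<kappa> * \<eta> * v (s k) $ j) + 1 / (real (s k) + 1) \<le> Re (\<kappa> * \<omega> * v (s k) $ i)"
        if "\<eta> \<in> phases e j" "(j, \<eta>) \<noteq> (i, \<omega>)" for j \<eta>
        using diff[OF top(2)] diff[OF that(1)] g2[OF that] small by linarith
    qed (use top in auto)
    then show False using v by blast
  qed
  then show ?thesis using that unfolding P_def by blast
qed

section \<open>The top exterior power at a symplectic family\<close>

text \<open>
  Composition with \<open>\<rho>\<close> only reindexes the sum over all permutations, at the cost of the factor
  \<open>sign \<rho>\<close>.
\<close>
lemma wedge_permute:
  assumes \<rho>: "\<rho> permutes {..<k + l}"
  shows "wedge k l a b (\<lambda>i. v (\<rho> i)) = of_int (sign \<rho>) * wedge k l a b v"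
proof -
  define g where "g = (\<lambda>\<sigma>. of_int (sign \<sigma>) * a (\<lambda>i. v (\<sigma> i)) * b (\<lambda>i. v (\<sigma> (k + i))))"
  have "(\<Sum>\<sigma> | \<sigma> permutes {..<k + l}. of_int (sign \<sigma>) * a (\<lambda>i. v (\<rho> (\<sigma> i))) * b (\<lambda>i. v (\<rho> (\<sigma> (k + i)))))
      = (\<Sum>\<sigma> | \<sigma> permutes {..<k + l}. of_int (sign \<rho>) * g (\<rho> \<circ> \<sigma>))"
  proof (rule sum.cong)
    fix \<sigma> assume "\<sigma> \<in> {\<sigma>. \<sigma> permutes {..<k + l}}"
    then have "sign (\<rho> \<circ> \<sigma>) = sign \<rho> * sign \<sigma>"
      using \<rho> by (intro sign_compose) (auto intro: permutes_imp_permutation)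
    then have "of_int (sign \<rho>) * of_int (sign (\<rho> \<circ> \<sigma>)) = (of_int (sign \<sigma>) :: complex)"
      by (simp flip: of_int_mult)
    then show "of_int (sign \<sigma>) * a (\<lambda>i. v (\<rho> (\<sigma> i))) * b (\<lambda>i. v (\<rho> (\<sigma> (k + i))))
        = of_int (sign \<rho>) * g (\<rho> \<circ> \<sigma>)"
      by (simp add: g_def mult.assoc[symmetric])
  qed simp
  also have "\<dots> = of_int (sign \<rho>) * (\<Sum>\<sigma> | \<sigma> permutes {..<k + l}. g \<sigma>)"
    unfolding sum_distrib_left[symmetric] using setum_permutations_compose_left[OF \<rho>, of g] by simp
  finally show ?thesis by (simp add: wedge_def g_def)
qed

lemma wedge_power2_permute:
  assumes "\<rho> permutes {..<2 * m}"
  shows "wedge_power2 \<omega> m (\<lambda>i. v (\<rho> i)) = of_int (sign \<rho>) * wedge_power2 \<omega> m v"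
proof (cases m)
  case 0
  then show ?thesis using assms by simp
next
  case (Suc m')
  then show ?thesis using assms wedge_permute[of \<rho> 2 "2 * m'" \<omega> "wedge_power2 \<omega> m'" v] by simp
qed

text \<open>
  Used to pass from a permutation of the arguments of a wedge product that fixes the arguments of the
  first factor to a permutation of the arguments of the second factor.
\<close>
lemma permutes_fixing_initial_segment:
  fixes \<rho> :: "nat \<Rightarrow> nat"
  assumes \<rho>: "\<rho> permutes {..<k + l}" and fixed: "\<And>i. i < k \<Longrightarrow> \<rho> i = i"
  obtains \<pi> where "\<pi> permutes {..<l}" "sign \<pi> = sign \<rho>" "\<And>i. \<rho> (k + i) = k + \<pi> i"
proof -
  define A where "A = {k..<k + l}"
  have A: "\<rho> permutes A"
    by (rule permutes_superset[OF \<rho>]) (use fixed in \<open>auto simp: A_def\<close>)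
  have bij: "bij_betw (\<lambda>i. i - k) A {..<l}"
    by (rule bij_betwI[where g = "\<lambda>i. i + k"]) (auto simp: A_def)
  define \<pi> where "\<pi> = map_permutation A (\<lambda>i. i - k) \<rho>"
  have inj: "inj_on (\<lambda>i. i - k) A" using bij by (rule bij_betw_imp_inj_on)
  have 1: "\<pi> permutes {..<l}" unfolding \<pi>_def by (rule map_permutation_permutes[OF bij A])
  have 2: "sign \<pi> = sign \<rho>" unfolding \<pi>_def by (rule sign_map_permutation[OF inj A]) (simp add: A_def)
  have 3: "\<rho> (k + i) = k + \<pi> i" for i
  proof (cases "i < l")
    case True
    then have iA: "k + i \<in> A" by (simp add: A_def)
    then have "\<pi> i = \<rho> (k + i) - k"
      using map_permutation_apply[OF inj iA, of \<rho>] by (simp add: \<pi>_def)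
    moreover have "\<rho> (k + i) \<in> A" using permutes_in_image[OF A] iA by simp
    ultimately show ?thesis by (simp add: A_def)
  next
    case False
    then show ?thesis using permutes_not_in[OF A] permutes_not_in[OF 1] by (simp add: A_def)
  qed
  show ?thesis using that 1 2 3 by blast
qed

text \<open>
  The Gram matrix of the standard symplectic form with respect to the basis \<open>(x\<^sub>1, y\<^sub>1, x\<^sub>2, y\<^sub>2, \<dots>)\<close>.
\<close>
definition pairing :: "nat \<Rightarrow> nat \<Rightarrow> complex" where
  "pairing i j = (if even i \<and> j = Suc i then 1 else if even j \<and> i = Suc j then - 1 else 0)"

lemma pairing_alt: "pairing i j = (if i div 2 = j div 2
    then (if even i \<and> odd j then 1 else if odd i \<and> even j then - 1 else 0) else 0)"
proof -
  have "even i \<and> j = Suc i \<longleftrightarrow> i div 2 = j div 2 \<and> even i \<and> odd j"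
    "even j \<and> i = Suc j \<longleftrightarrow> i div 2 = j div 2 \<and> odd i \<and> even j" by presburger+
  then show ?thesis unfolding pairing_def by auto
qed

text \<open>
  Every nonzero summand of the wedge product is positive, so no cancellation occurs. A nonzero summand belongs to a permutation \<open>\<sigma>\<close> that
  sends \<open>{0, 1}\<close> to some pair \<open>{c, c + 1}\<close> with even \<open>c\<close>. The even permutation \<open>\<tau>\<close> that
  exchanges this pair with \<open>{0, 1}\<close> preserves the symplectic relations. Up to \<open>\<tau>\<close>, and up to the
  transposition of \<open>0\<close> and \<open>1\<close>, which changes the sign twice, \<open>\<sigma>\<close> fixes \<open>0\<close> and \<open>1\<close>, and the induction
  hypothesis applies to the remaining vectors.
\<close>
lemma wedge_power2_pos:
  assumes "\<And>i j. i < 2 * m \<Longrightarrow> j < 2 * m \<Longrightarrow> B (v i) (v j) = pairing i j"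
  shows "\<exists>r>0. wedge_power2 (\<lambda>v. B (v 0) (v 1)) m v = of_real r"
  using assms
proof (induction m arbitrary: v)
  case 0
  then show ?case by (intro exI[of _ 1]) simp
next
  case (Suc m)
  let ?W = "wedge_power2 (\<lambda>v. B (v 0) (v 1)) m"
  let ?P = "{\<sigma>. \<sigma> permutes {..<2 + 2 * m}}"
  define summand where "summand = (\<lambda>\<sigma>. of_int (sign \<sigma>) * B (v (\<sigma> 0)) (v (\<sigma> 1)) * ?W (\<lambda>i. v (\<sigma> (2 + i))))"
  have B: "B (v i) (v j) = pairing i j" if "i < 2 + 2 * m" "j < 2 + 2 * m" for i j
    using Suc.prems that by simp
  have fixing: "\<exists>r>0. of_int (sign \<rho>) * ?W (\<lambda>i. v (\<tau> (\<rho> (2 + i)))) = of_real r"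
    if \<rho>: "\<rho> permutes {..<2 + 2 * m}" "\<rho> 0 = 0" "\<rho> 1 = 1"
      and \<tau>: "\<tau> permutes {..<2 + 2 * m}" "\<And>i j. pairing (\<tau> i) (\<tau> j) = pairing i j" for \<rho> \<tau>
  proof -
    have fix2: "\<rho> i = i" if "i < 2" for i using that \<rho> by (auto simp: less_2_cases_iff)
    obtain \<pi> where \<pi>: "\<pi> permutes {..<2 * m}" "sign \<pi> = sign \<rho>" "\<And>i. \<rho> (2 + i) = 2 + \<pi> i"
      using permutes_fixing_initial_segment[OF \<rho>(1) fix2] by blast
    have "\<exists>r>0. ?W (\<lambda>i. v (\<tau> (2 + i))) = of_real r"
    proof (rule Suc.IH)
      fix i j assume ij: "i < 2 * m" "j < 2 * m"
      then have "\<tau> (2 + i) < 2 + 2 * m" "\<tau> (2 + j) < 2 + 2 * m"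
        using permutes_in_image[OF \<tau>(1)] by auto
      then show "B (v (\<tau> (2 + i))) (v (\<tau> (2 + j))) = pairing i j"
        by (simp only: B \<tau>(2)) (simp add: pairing_def)
    qed
    moreover have "of_int (sign \<rho>) * ?W (\<lambda>i. v (\<tau> (\<rho> (2 + i)))) = ?W (\<lambda>i. v (\<tau> (2 + i)))"
      unfolding \<pi>(3) using wedge_power2_permute[OF \<pi>(1), of "\<lambda>v. B (v 0) (v 1)" "\<lambda>i. v (\<tau> (2 + i))"]
      by (simp add: \<pi>(2) mult.assoc[symmetric] flip: of_int_mult)
    ultimately show ?thesis by simp
  qed
  have term_pos: "\<exists>r>0. summand \<sigma> = of_real r"
    if \<sigma>: "\<sigma> permutes {..<2 + 2 * m}" and nz: "pairing (\<sigma> 0) (\<sigma> 1) \<noteq> 0" for \<sigma>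
  proof -
    have lt: "\<sigma> 0 < 2 + 2 * m" "\<sigma> 1 < 2 + 2 * m"
      using permutes_in_image[OF \<sigma>, of 0] permutes_in_image[OF \<sigma>, of 1] by auto
    define c where "c = min (\<sigma> 0) (\<sigma> 1)"
    have c: "even c" "\<sigma> 0 = c \<and> \<sigma> 1 = Suc c \<or> \<sigma> 0 = Suc c \<and> \<sigma> 1 = c" "Suc c < 2 + 2 * m"
      using nz lt by (auto simp: c_def pairing_def split: if_splits)
    define \<tau> where "\<tau> = Transposition.transpose 0 c \<circ> Transposition.transpose 1 (Suc c)"
    have \<tau>: "\<tau> permutes {..<2 + 2 * m}"
      unfolding \<tau>_def using c by (intro permutes_compose permutes_swap_id) auto
    have sgn\<tau>: "sign \<tau> = 1"
      unfolding \<tau>_def by (simp add: sign_compose permutation_swap_id sign_swap_id)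
    obtain k where k: "c = 2 * k" using c(1) by (rule evenE)
    have \<tau>_eq: "\<tau> i = (if i = 0 then 2 * k else if i = 1 then Suc (2 * k)
        else if i = 2 * k then 0 else if i = Suc (2 * k) then 1 else i)" for i
      by (simp add: \<tau>_def k Transposition.transpose_def)
    have "even (\<tau> i) = even i" for i by (simp add: \<tau>_eq)
    moreover have "\<tau> i div 2 = Transposition.transpose 0 k (i div 2)" for i
    proof -
      have "i = 2 * (i div 2) \<or> i = Suc (2 * (i div 2))" by presburger
      then obtain l where "i = 2 * l \<or> i = Suc (2 * l)" by blast
      then show ?thesis by (elim disjE) (simp_all add: \<tau>_eq Transposition.transpose_def)
    qed
    moreover have "Transposition.transpose 0 k a = Transposition.transpose 0 k b \<longleftrightarrow> a = b" for a b
      by (metis transpose_involutory)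
    ultimately have pair\<tau>: "pairing (\<tau> i) (\<tau> j) = pairing i j" for i j
      unfolding pairing_alt by (simp only:)
    have \<tau>\<tau>: "\<tau> (\<tau> i) = i" for i
      by (simp add: \<tau>_eq)
    define \<rho> where "\<rho> = \<tau> \<circ> \<sigma>"
    have \<rho>: "\<rho> permutes {..<2 + 2 * m}" unfolding \<rho>_def by (rule permutes_compose[OF \<sigma> \<tau>])
    have \<sigma>\<rho>: "\<sigma> i = \<tau> (\<rho> i)" for i by (simp add: \<rho>_def \<tau>\<tau>)
    have sgn\<rho>: "sign \<rho> = sign \<sigma>"
      unfolding \<rho>_def using \<sigma> \<tau> sgn\<tau> by (subst sign_compose) (auto intro: permutes_imp_permutation)
    have tau01: "\<tau> c = 0" "\<tau> (Suc c) = 1"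
      by (simp_all add: \<tau>_eq k)
    from c(2) show ?thesis
    proof
      assume s: "\<sigma> 0 = c \<and> \<sigma> 1 = Suc c"
      then have "\<rho> 0 = 0" "\<rho> 1 = 1" by (simp_all add: \<rho>_def tau01)
      moreover have "B (v (\<sigma> 0)) (v (\<sigma> 1)) = 1" using B lt s c(1) by (simp add: pairing_def)
      ultimately show ?thesis
        using fixing[OF \<rho> _ _ \<tau> pair\<tau>] by (simp add: summand_def sgn\<rho> flip: \<sigma>\<rho>)
    next
      assume s: "\<sigma> 0 = Suc c \<and> \<sigma> 1 = c"
      define \<rho>' where "\<rho>' = \<rho> \<circ> Transposition.transpose 0 1"
      have "\<rho>' permutes {..<2 + 2 * m}"
        unfolding \<rho>'_def by (intro permutes_compose[OF _ \<rho>] permutes_swap_id) auto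
      moreover have "\<rho>' 0 = 0" "\<rho>' 1 = 1" using s by (simp_all add: \<rho>'_def \<rho>_def tau01)
      moreover have "sign \<rho>' = - sign \<sigma>"
        unfolding \<rho>'_def using \<rho> sgn\<rho>
        by (subst sign_compose) (auto intro: permutes_imp_permutation simp: permutation_swap_id sign_swap_id)
      moreover have "\<rho>' (2 + i) = \<rho> (2 + i)" for i by (simp add: \<rho>'_def Transposition.transpose_def)
      moreover have "B (v (\<sigma> 0)) (v (\<sigma> 1)) = - 1" using B lt s c(1) by (simp add: pairing_def)
      ultimately show ?thesis
        using fixing[of \<rho>' \<tau>, OF _ _ _ \<tau> pair\<tau>] by (simp add: summand_def flip: \<sigma>\<rho>)
    qed
  qed
  have "\<exists>t. t \<ge> 0 \<and> summand \<sigma> = of_real t" if \<sigma>: "\<sigma> \<in> ?P" for \<sigma>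
  proof (cases "pairing (\<sigma> 0) (\<sigma> 1) = 0")
    case True
    have "\<sigma> 0 < 2 + 2 * m" "\<sigma> 1 < 2 + 2 * m"
      using \<sigma> permutes_in_image[of \<sigma> "{..<2 + 2 * m}" 0] permutes_in_image[of \<sigma> "{..<2 + 2 * m}" 1] by auto
    then show ?thesis using B True by (intro exI[of _ 0]) (simp add: summand_def)
  next
    case False
    then show ?thesis using term_pos[of \<sigma>] \<sigma> by (auto intro: less_imp_le)
  qed
  then obtain t where t: "\<And>\<sigma>. \<sigma> \<in> ?P \<Longrightarrow> t \<sigma> \<ge> 0" "\<And>\<sigma>. \<sigma> \<in> ?P \<Longrightarrow> summand \<sigma> = of_real (t \<sigma>)"
    by metis
  have id: "id \<in> ?P" by (simp add: permutes_id)
  obtain r where "r > 0" "summand id = of_real r"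
    using term_pos[OF permutes_id] by (auto simp: pairing_def)
  then have "t id > 0" using t(2)[OF id] by simp
  then have "0 < sum t ?P"
    using id t(1) by (intro sum_pos2[of ?P id t]) (auto simp: finite_permutations)
  moreover have "wedge_power2 (\<lambda>v. B (v 0) (v 1)) (Suc m) v = (\<Sum>\<sigma>\<in>?P. summand \<sigma>) / (fact 2 * fact (2 * m))"
    by (simp add: wedge_def summand_def)
  moreover have "(\<Sum>\<sigma>\<in>?P. summand \<sigma>) = of_real (sum t ?P)"
    unfolding of_real_sum by (rule sum.cong) (use t(2) in auto)
  ultimately show ?case
    by (intro exI[of _ "sum t ?P / (fact 2 * fact (2 * m))"]) simp
qed

text \<open>
  As \<open>a\<close> vanishes on all vectors but the first, only the permutations that fix \<open>0\<close>
  contribute, and all of them contribute the same nonzero amount.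
\<close>
lemma wedge_symplectic_family_nonzero:
  assumes a0: "a (v 0) \<noteq> 0" and a: "\<And>i. i < 2 * n \<Longrightarrow> a (v (Suc i)) = 0"
    and B: "\<And>i j. i < 2 * n \<Longrightarrow> j < 2 * n \<Longrightarrow> B (v (Suc i)) (v (Suc j)) = pairing i j"
  shows "wedge 1 (2 * n) (\<lambda>v. a (v 0)) (wedge_power2 (\<lambda>v. B (v 0) (v 1)) n) v \<noteq> 0"
proof -
  let ?W = "wedge_power2 (\<lambda>v. B (v 0) (v 1)) n"
  let ?P = "{\<sigma>. \<sigma> permutes {..<1 + 2 * n}}"
  obtain r where r: "r > 0" "?W (\<lambda>i. v (Suc i)) = of_real r"
    using wedge_power2_pos[of n B "\<lambda>i. v (Suc i)"] B by blast
  have "of_int (sign \<sigma>) * a (v (\<sigma> 0)) * ?W (\<lambda>i. v (\<sigma> (1 + i)))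
      = (if \<sigma> 0 = 0 then a (v 0) * of_real r else 0)" if \<sigma>: "\<sigma> \<in> ?P" for \<sigma>
  proof (cases "\<sigma> 0 = 0")
    case True
    then have fix1: "\<sigma> i = i" if "i < 1" for i using that by simp
    obtain \<pi> where \<pi>: "\<pi> permutes {..<2 * n}" "sign \<pi> = sign \<sigma>" "\<And>i. \<sigma> (1 + i) = 1 + \<pi> i"
      using permutes_fixing_initial_segment[of \<sigma> 1 "2 * n"] \<sigma> fix1 by blast
    have "?W (\<lambda>i. v (Suc (\<pi> i))) = of_int (sign \<sigma>) * of_real r"
      using wedge_power2_permute[OF \<pi>(1), of "\<lambda>v. B (v 0) (v 1)" "\<lambda>i. v (Suc i)"] r by (simp add: \<pi>(2))
    moreover have "of_int (sign \<sigma>) * of_int (sign \<sigma>) = (1 :: complex)"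
      by (simp flip: of_int_mult)
    ultimately show ?thesis using True by (simp add: \<pi>(3)[simplified] mult.assoc mult.left_commute)
  next
    case False
    then obtain i where "\<sigma> 0 = Suc i" by (cases "\<sigma> 0") auto
    moreover have "\<sigma> 0 < 1 + 2 * n" using \<sigma> permutes_in_image[of \<sigma> "{..<1 + 2 * n}" 0] by simp
    ultimately show ?thesis using a by simp
  qed
  then have "(\<Sum>\<sigma>\<in>?P. of_int (sign \<sigma>) * a (v (\<sigma> 0)) * ?W (\<lambda>i. v (\<sigma> (1 + i))))
      = (\<Sum>\<sigma>\<in>?P. if \<sigma> 0 = 0 then a (v 0) * of_real r else 0)" by (intro sum.cong) auto
  also have "\<dots> = of_nat (card {\<sigma> \<in> ?P. \<sigma> 0 = 0}) * (a (v 0) * of_real r)"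
    by (simp add: sum.If_cases finite_permutations Int_def)
  also have "\<dots> \<noteq> 0"
  proof -
    have "id \<in> {\<sigma> \<in> ?P. \<sigma> 0 = 0}" by (simp add: permutes_id)
    moreover have "finite {\<sigma> \<in> ?P. \<sigma> 0 = 0}" by (simp add: finite_permutations)
    ultimately have "card {\<sigma> \<in> ?P. \<sigma> 0 = 0} \<noteq> 0" unfolding card_eq_0_iff by blast
    then show ?thesis using a0 r by simp
  qed
  finally show ?thesis by (simp add: wedge_def)
qed

section \<open>Lines in the standard contact structure\<close>

lemma complex_linear_iff:
  fixes D :: "complex ^ 'd::finite \<Rightarrow> complex"
  shows "Vector_Spaces.linear (*s) (*) D \<longleftrightarrow>
    (\<forall>x y. D (x + y) = D x + D y) \<and> (\<forall>c x. D (c *s x) = c * D x)"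
  unfolding Vector_Spaces.linear_iff
  using vec.vector_space_axioms vector_space_over_itself.vector_space_axioms by blast

lemma has_derivative_vecI:
  fixes f :: "'a::real_normed_vector \<Rightarrow> complex ^ 'd::finite"
  assumes "\<And>i. ((\<lambda>s. f s $ i) has_derivative (\<lambda>w. D w $ i)) (at x)"
  shows "(f has_derivative D) (at x)"
proof (subst has_derivative_componentwise_within, rule ballI)
  fix b :: "complex ^ 'd" assume "b \<in> Basis"
  then obtain i u where b: "b = axis i u" by (auto simp: Basis_vec_def)
  have "((\<lambda>s. f s $ i \<bullet> u) has_derivative (\<lambda>w. D w $ i \<bullet> u)) (at x)"
    by (intro has_derivative_inner_left assms)
  then show "((\<lambda>s. f s \<bullet> b) has_derivative (\<lambda>w. D w \<bullet> b)) (at x)"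
    by (simp add: b inner_axis)
qed

lemma holomorphic_curve_has_derivative:
  assumes "holomorphic_curve f"
  shows "(f has_derivative (\<lambda>w. w *s (\<chi> i. deriv (\<lambda>s. f s $ i) t))) (at t)"
proof (rule has_derivative_vecI)
  fix i
  have "((\<lambda>s. f s $ i) has_field_derivative deriv (\<lambda>s. f s $ i) t) (at t)"
    using assms unfolding holomorphic_curve_def
    by (intro holomorphic_derivI[of _ UNIV]) auto
  then show "((\<lambda>s. f s $ i) has_derivative (\<lambda>w. (w *s (\<chi> i. deriv (\<lambda>s. f s $ i) t)) $ i)) (at t)"
    by (simp add: has_field_derivative_def mult_commute_abs)
qed

lemma holomorphic_map_differentiable:
  assumes "holomorphic_map F" shows "\<exists>D. (F has_derivative D) (at p)"
proof -
  have "\<forall>i. \<exists>D. ((\<lambda>p. F p $ i) has_derivative D) (at p)"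
    using assms unfolding holomorphic_map_def holomorphic_fun_def by blast
  then obtain D where D: "\<And>i. ((\<lambda>p. F p $ i) has_derivative D i) (at p)" by metis
  have "(F has_derivative (\<lambda>w. \<chi> i. D i w)) (at p)" by (rule has_derivative_vecI) (simp add: D)
  then show ?thesis by blast
qed

lemma bounded_linear_scale_vec: "bounded_linear (\<lambda>w. w *s (b :: complex ^ 'd::finite))"
proof -
  have "((\<lambda>w. w *s b) has_derivative (\<lambda>w. w *s b)) (at 0)"
    by (rule has_derivative_vecI) (auto intro!: derivative_eq_intros)
  then show ?thesis by (rule has_derivative_bounded_linear)
qed

text \<open>
  The line \<open>t \<mapsto> t \<cdot> b\<close> in the direction of a coordinate \<open>x\<^sub>j\<close> is tangent to the standard contact
  structure. Its preimage under a contactomorphism is a nonconstant entire curve tangent to \<open>ker \<alpha>\<close>.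
\<close>
lemma not_contactomorphic_standard:
  fixes \<alpha> :: "'n::finite cspace \<Rightarrow> 'n cspace \<Rightarrow> complex"
  assumes hyp: "\<And>f. holomorphic_curve f \<Longrightarrow> (\<And>t w. pullback f \<alpha> t w = 0) \<Longrightarrow> f constant_on UNIV"
  shows "\<not> contactomorphic \<alpha> standard_contact_form"
proof
  assume "contactomorphic \<alpha> standard_contact_form"
  then obtain F :: "'n cspace \<Rightarrow> 'n cspace" where F: "biholomorphic F" and
    img: "\<And>p. frechet_derivative F (at p) ` contact_subspace \<alpha> p
            = contact_subspace standard_contact_form (F p)"
    unfolding contactomorphic_def by blast
  define G where "G = inv F"
  have bij: "bij F" and holF: "holomorphic_map F" and holG: "holomorphic_map G"
    using F by (auto simp: biholomorphic_def G_def)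
  have FG: "F (G q) = q" and GF: "G (F p) = p" for p q
    using bij by (simp_all add: G_def bij_is_surj bij_is_inj surj_f_inv_f)
  fix j :: 'n
  define b :: "'n cspace" where "b = axis (Inl j) 1"
  define f where "f = (\<lambda>t. G (t *s b))"
  have line: "((\<lambda>t. t *s b) has_derivative (\<lambda>w. w *s b)) (at t)" for t
    by (rule bounded_linear_imp_has_derivative[OF bounded_linear_scale_vec])
  have hol: "holomorphic_curve f"
    unfolding holomorphic_curve_def
  proof
    fix i
    have "(\<lambda>t. f t $ i) field_differentiable at t" for t
    proof -
      obtain D where D: "((\<lambda>p. G p $ i) has_derivative D) (at (t *s b))" "Vector_Spaces.linear (*s) (*) D"
        using holG unfolding holomorphic_map_def holomorphic_fun_def by blast
      have "((\<lambda>t. G (t *s b) $ i) has_derivative (\<lambda>w. D (w *s b))) (at t)"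
        by (rule has_derivative_compose[OF line D(1)])
      moreover have "D (w *s b) = D b * w" for w using D(2) by (simp add: complex_linear_iff)
      ultimately show ?thesis
        unfolding field_differentiable_def has_field_derivative_def f_def by auto
    qed
    then show "(\<lambda>t. f t $ i) holomorphic_on UNIV"
      by (simp add: holomorphic_on_def field_differentiable_at_within)
  qed
  have "pullback f \<alpha> t w = 0" for t w
  proof -
    obtain D where D: "(F has_derivative D) (at (f t))"
      using holomorphic_map_differentiable[OF holF] by blast
    obtain E where E: "(G has_derivative E) (at (F (f t)))"
      using holomorphic_map_differentiable[OF holG] by blast
    obtain f' where f': "(f has_derivative f') (at t)"
      using holomorphic_curve_has_derivative[OF hol] by blast
    have "((\<lambda>p. G (F p)) has_derivative (\<lambda>u. E (D u))) (at (f t))"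
      by (rule has_derivative_compose[OF D E])
    then have ED: "E (D u) = u" for u
      using has_derivative_unique[OF _ has_derivative_ident] unfolding GF by metis
    have "((\<lambda>s. F (f s)) has_derivative (\<lambda>u. D (f' u))) (at t)"
      by (rule has_derivative_compose[OF f' D])
    then have Df': "D (f' w) = w *s b"
      using has_derivative_unique[OF _ line] unfolding f_def FG by metis
    have "w *s b \<in> contact_subspace standard_contact_form (F (f t))"
      by (simp add: contact_subspace_def standard_contact_form_def b_def axis_def)
    then have "w *s b \<in> D ` contact_subspace \<alpha> (f t)"
      using img[of "f t"] frechet_derivative_at[OF D] by simp
    then obtain u where u: "\<alpha> (f t) u = 0" "D u = w *s b"
      by (auto simp: contact_subspace_def)
    then have "u = f' w" using ED Df' by metis
    then show ?thesis using u frechet_derivative_at[OF f'] by (simp add: pullback_def)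
  qed
  then have "f constant_on UNIV" by (rule hyp[OF hol])
  then have "F (f 0) = F (f 1)" unfolding constant_on_def by (metis UNIV_I)
  then have "0 *s b = 1 *s b" unfolding f_def FG .
  then show False by (simp add: b_def axis_eq_0_iff)
qed

section \<open>The exponential contact form\<close>

text \<open>
  The form \<open>dE + \<Sum>\<^sub>j x\<^sub>j dy\<^sub>j\<close> with \<open>E(p) = \<Sum>\<^sub>i \<Sum>\<^sub>\<omega> exp (\<omega> p\<^sub>i)\<close>.
\<close>
definition exp_form :: "('n + 'n + unit \<Rightarrow> nat) \<Rightarrow> 'n::finite cspace \<Rightarrow> 'n cspace \<Rightarrow> complex" where
  "exp_form e p v = (\<Sum>i\<in>UNIV. \<Sum>\<omega>\<in>phases e i. \<omega> * exp (\<omega> * p $ i) * v $ i)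
     + (\<Sum>j\<in>UNIV. xcoord p j * ycoord v j)"

lemma exp_form_linear: "Vector_Spaces.linear (*s) (*) (exp_form e p)"
  unfolding complex_linear_iff
  by (simp add: exp_form_def algebra_simps sum.distrib sum_distrib_left)

lemma has_derivative_nth [derivative_intros]:
  "((\<lambda>p. p $ i) has_derivative (\<lambda>u. u $ i)) F"
  by (rule bounded_linear_imp_has_derivative[OF bounded_linear_vec_nth])

lemma has_derivative_exp_coordinate [derivative_intros]:
  fixes p :: "complex ^ 'd::finite"
  shows "((\<lambda>p. exp (\<omega> * p $ i)) has_derivative (\<lambda>u. \<omega> * u $ i * exp (\<omega> * p $ i))) (at p)"
proof -
  have "((\<lambda>p. \<omega> * p $ i) has_derivative (\<lambda>u. \<omega> * u $ i)) (at p)"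
    by (intro has_derivative_mult_right has_derivative_nth)
  from has_derivative_compose[OF this DERIV_exp[unfolded has_field_derivative_def]]
  show ?thesis by (simp add: mult_ac)
qed

lemma exp_form_has_derivative:
  "((\<lambda>p. exp_form e p v) has_derivative
     (\<lambda>u. (\<Sum>i\<in>UNIV. \<Sum>\<omega>\<in>phases e i. \<omega> * (\<omega> * u $ i * exp (\<omega> * p $ i)) * v $ i)
        + (\<Sum>j\<in>UNIV. xcoord u j * ycoord v j))) (at p)"
  unfolding exp_form_def
  by (auto intro!: derivative_eq_intros sum.cong ext simp: mult_ac)

lemma exp_form_holomorphic: "holomorphic_1form (exp_form e)"
  unfolding holomorphic_1form_def holomorphic_fun_def
proof (intro conjI allI exI)
  show "Vector_Spaces.linear (*s) (*) (exp_form e p)" for p by (rule exp_form_linear)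
  show "((\<lambda>q. exp_form e q (axis i 1)) has_derivative
     (\<lambda>u. (\<Sum>k\<in>UNIV. \<Sum>\<omega>\<in>phases e k. \<omega> * (\<omega> * u $ k * exp (\<omega> * p $ k)) * axis i 1 $ k)
        + (\<Sum>j\<in>UNIV. xcoord u j * ycoord (axis i 1) j))) (at p)" for i p
    by (rule exp_form_has_derivative)
  show "Vector_Spaces.linear (*s) (*) 
     (\<lambda>u. (\<Sum>k\<in>UNIV. \<Sum>\<omega>\<in>phases e k. \<omega> * (\<omega> * u $ k * exp (\<omega> * p $ k)) * axis i 1 $ k)
        + (\<Sum>j\<in>UNIV. xcoord u j * ycoord (axis i 1) j))" for i p
    unfolding complex_linear_iff
    by (simp add: algebra_simps sum.distrib sum_distrib_left)
qed

text \<open>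
  The exact part \<open>dE\<close> drops out: its derivative is a symmetric bilinear form.
\<close>
lemma ext_deriv_exp_form:
  "ext_deriv (exp_form e) p u v = (\<Sum>j\<in>UNIV. xcoord u j * ycoord v j - xcoord v j * ycoord u j)"
  unfolding ext_deriv_def frechet_derivative_at[OF exp_form_has_derivative, symmetric]
  by (simp add: sum_subtractf mult_ac)

text \<open>
  With label \<open>0\<close> for \<open>z\<close>, the form takes the nonzero value \<open>exp z\<close> on the direction of \<open>z\<close>, which lies in the kernel
  of \<open>d\<alpha>\<close>. Subtracting multiples of it from the remaining basis vectors moves them into \<open>ker \<alpha>\<close>
  without changing the values of \<open>d\<alpha>\<close>.
\<close>
lemma exp_form_contact:
  fixes e :: "'n::finite + 'n + unit \<Rightarrow> nat"
  assumes z: "e (Inr (Inr ())) = 0"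
  shows "holomorphic_contact_form (exp_form e)"
  unfolding holomorphic_contact_form_def
proof (intro conjI allI exp_form_holomorphic)
  fix p :: "'n cspace"
  let ?z = "Inr (Inr ()) :: 'n + 'n + unit"
  let ?a = "exp_form e p"
  let ?B = "\<lambda>u v :: 'n cspace. \<Sum>j\<in>UNIV. xcoord u j * ycoord v j - xcoord v j * ycoord u j"
  obtain h :: "nat \<Rightarrow> 'n" where h: "bij_betw h {..<CARD('n)} UNIV"
    using ex_bij_betw_nat_finite[of "UNIV :: 'n set"] by (auto simp: atLeast0LessThan)
  have lin: "?a (x - c *s y) = ?a x - c * ?a y" for x y c
  proof -
    have "?a (x + (- c) *s y) = ?a x + (- c) * ?a y"
      using exp_form_linear[of e p] unfolding complex_linear_iff by metis
    moreover have "x - c *s y = x + (- c) *s y" by (simp add: vec_eq_iff)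
    ultimately show ?thesis by (metis add_uminus_conv_diff mult_minus_left)
  qed
  have "phases e ?z = {1}" by (auto simp: phases_def z)
  have az: "?a (axis ?z 1) = exp (p $ ?z)"
  proof -
    have "?a (axis ?z 1) = (\<Sum>i\<in>UNIV. \<Sum>\<omega>\<in>phases e i. \<omega> * exp (\<omega> * p $ i) * axis ?z 1 $ i)"
      by (simp add: exp_form_def) (simp add: axis_def)
    also have "\<dots> = (\<Sum>i\<in>UNIV. if i = ?z then (\<Sum>\<omega>\<in>phases e i. \<omega> * exp (\<omega> * p $ i)) else 0)"
      by (rule sum.cong) (auto simp: axis_def)
    also have "\<dots> = exp (p $ ?z)" using \<open>phases e ?z = {1}\<close> by simp
    finally show ?thesis .
  qed
  define w where "w = (\<lambda>k. axis k 1 - (?a (axis k 1) / ?a (axis ?z 1)) *s axis ?z 1)"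
  define k where "k = (\<lambda>i. if even i then Inl (h (i div 2)) else Inr (Inl (h (i div 2))) :: 'n + 'n + unit)"
  define v where "v = (\<lambda>i. case i of 0 \<Rightarrow> axis ?z 1 | Suc i \<Rightarrow> w (k i))"
  have xw: "xcoord (w i) j = (if i = Inl j then 1 else 0)"
    and yw: "ycoord (w i) j = (if i = Inr (Inl j) then 1 else 0)" for i j
    by (auto simp: w_def axis_def)
  have "wedge 1 (2 * CARD('n)) (\<lambda>v. ?a (v 0)) (wedge_power2 (\<lambda>v. ?B (v 0) (v 1)) CARD('n)) v \<noteq> 0"
  proof (rule wedge_symplectic_family_nonzero)
    show "?a (v 0) \<noteq> 0" by (simp add: v_def az)
    show "?a (v (Suc i)) = 0" for i by (simp add: v_def w_def lin az)
    fix i j assume ij: "i < 2 * CARD('n)" "j < 2 * CARD('n)"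
    have hh: "h (i div 2) = h (j div 2) \<longleftrightarrow> i div 2 = j div 2"
      using bij_betw_imp_inj_on[OF h] ij by (auto simp: inj_on_eq_iff)
    then have hh': "h (j div 2) = h (i div 2) \<longleftrightarrow> i div 2 = j div 2" by metis
    have 1: "(\<Sum>l\<in>UNIV. (if x = l then 1 else 0) * (if y = l then 1 else 0)) = (if x = y then 1 else (0::complex))"
      for x y :: 'n
      by (simp add: if_distrib[of "\<lambda>c. c * _"] cong: if_cong)
    show "?B (v (Suc i)) (v (Suc j)) = pairing i j"
    proof (cases "even i"; cases "even j")
      assume "even i" "\<not> even j"
      then show ?thesis by (simp add: v_def k_def xw yw pairing_alt 1 hh)
    next
      assume "\<not> even i" "even j"
      then show ?thesis by (simp add: v_def k_def xw yw pairing_alt sum_negf 1 hh')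
    qed (simp_all add: v_def k_def xw yw pairing_alt)
  qed
  then show "wedge 1 (2 * CARD('n)) (\<lambda>v. ?a (v 0))
      (wedge_power2 (\<lambda>v. ext_deriv (exp_form e) p (v 0) (v 1)) CARD('n)) \<noteq> (\<lambda>v. 0)"
    unfolding ext_deriv_exp_form by (auto simp: fun_eq_iff)
qed

section \<open>Entire curves tangent to the exponential contact form\<close>

text \<open>
  Write \<open>p\<close> and \<open>u\<close> for the position and the velocity of the rescaled curve at the parameter \<open>\<tau>0\<close> with
  \<open>exp \<tau>0 = \<kappa>\<close>. Both are within \<open>\<delta> M\<close> of \<open>\<kappa> \<cdot> a\<close>, where \<open>M = \<parallel>a\<parallel>\<close>; for the velocity this is Cauchy's
  estimate. The term of the untied exponent has at least the size of \<open>M \<cdot> exp (M (g - \<gamma> / 4))\<close>, every other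
  term at most that of \<open>M \<cdot> exp (M (g - 3 \<gamma> / 4))\<close>, and the remainder \<open>\<Sum>\<^sub>j x\<^sub>j dy\<^sub>j\<close> at most that of
  \<open>M\<^sup>2\<close>. Because \<open>g \<ge> \<gamma>\<close>, these terms cannot add up to zero when \<open>M\<close> is large.
\<close>
lemma exp_form_entire_curve_constant:
  fixes f :: "complex \<Rightarrow> 'n::finite cspace"
  assumes e: "inj e" and hol: "holomorphic_curve f"
    and tangent: "\<And>t w. pullback f (exp_form e) t w = 0"
  shows "f constant_on UNIV"
proof (rule ccontr)
  assume nonconst: "\<not> f constant_on UNIV"
  obtain \<gamma> where \<gamma>: "\<gamma> > 0" and untied: "\<And>v :: 'n cspace. norm v = 1 \<Longrightarrow>
    \<exists>\<kappa> i \<omega>. norm \<kappa> = 1 \<and> \<omega> \<in> phases e i \<and> \<gamma> \<le> Re (\<kappa> * \<omega> * v $ i) \<and>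
      (\<forall>j \<eta>. \<eta> \<in> phases e j \<longrightarrow> (j, \<eta>) \<noteq> (i, \<omega>) \<longrightarrow>
         Re (\<kappa> * \<eta> * v $ j) + \<gamma> \<le> Re (\<kappa> * \<omega> * v $ i))"
    by (rule uniformly_untied_exponent[OF e]) blast
  define T where "T = Sigma UNIV (phases e)"
  have finT: "finite T" by (simp add: T_def)
  define \<delta> where "\<delta> = \<gamma> / 4"
  have \<delta>: "\<delta> > 0" using \<gamma> by (simp add: \<delta>_def)
  have "\<forall>\<^sub>F M in at_top. 2 * real (card T) * exp (- (\<gamma> / 2) * M)
      + 4 * real CARD('n) * M * exp (- (3 * \<gamma> / 4) * M) < 3 * \<gamma> / 4"
  proof (rule order_tendstoD(2))
    show "((\<lambda>M. 2 * real (card T) * exp (- (\<gamma> / 2) * M)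
      + 4 * real CARD('n) * M * exp (- (3 * \<gamma> / 4) * M)) \<longlongrightarrow> 0) at_top"
      using \<gamma> by real_asymp
  qed (use \<gamma> in simp)
  then obtain C where C: "\<And>M. M \<ge> C \<Longrightarrow> 2 * real (card T) * exp (- (\<gamma> / 2) * M)
      + 4 * real CARD('n) * M * exp (- (3 * \<gamma> / 4) * M) < 3 * \<gamma> / 4"
    unfolding eventually_at_top_linorder by blast
  \<comment> \<open>The radius \<open>5\<close> leaves room for Cauchy's estimate on the unit disc around any \<open>\<tau>0\<close> with
    \<open>\<parallel>\<tau>0\<parallel> \<le> \<pi> < 4\<close>.\<close>
  obtain c \<mu> where big: "norm (f (exp c)) \<ge> max C 1" and
    near: "\<And>\<tau>. norm \<tau> \<le> 5 \<Longrightarrow> norm (f (exp (c + of_real \<mu> * \<tau>)) - exp \<tau> *s f (exp c))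
        \<le> \<delta> * norm (f (exp c))"
    by (rule wiman_valiron[OF hol nonconst _ \<delta>, of 5 "max C 1"]) auto
  define a where "a = f (exp c)"
  define M where "M = norm a"
  have M: "M \<ge> 1" "M \<ge> C" using big by (auto simp: M_def a_def)
  then have "a \<noteq> 0" by (auto simp: M_def)
  define v where "v = (1 / M) *\<^sub>R a"
  have norm_v: "norm v = 1" using \<open>a \<noteq> 0\<close> by (simp add: v_def M_def)
  have av: "a $ k = of_real M * v $ k" for k
  proof -
    have "v $ k = of_real (1 / M) * a $ k"
      using scaleR_conv_of_real[of "1 / M" "a $ k"] by (simp only: v_def vector_scaleR_component)
    then show ?thesis using M by simp
  qed
  have v_le: "norm (v $ k) \<le> 1" for k
    using Finite_Cartesian_Product.norm_nth_le[of v k] norm_v by simp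
  obtain \<kappa> i \<omega> where \<kappa>: "norm \<kappa> = 1" and \<omega>: "\<omega> \<in> phases e i"
    and top: "\<gamma> \<le> Re (\<kappa> * \<omega> * v $ i)"
    and gap: "\<And>j \<eta>. \<eta> \<in> phases e j \<Longrightarrow> (j, \<eta>) \<noteq> (i, \<omega>) \<Longrightarrow>
         Re (\<kappa> * \<eta> * v $ j) + \<gamma> \<le> Re (\<kappa> * \<omega> * v $ i)"
    using untied[OF norm_v] by blast
  define g where "g = Re (\<kappa> * \<omega> * v $ i)"
  have vi: "\<gamma> \<le> norm (v $ i)"
    using top complex_Re_le_cmod[of "\<kappa> * \<omega> * v $ i"] \<kappa> norm_phase[OF \<omega>] by (simp add: norm_mult)
  then have \<delta>1: "\<delta> \<le> 1" using v_le[of i] \<gamma> unfolding \<delta>_def by linarith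
  define \<tau>0 where "\<tau>0 = Ln \<kappa>"
  have exp\<tau>0: "exp \<tau>0 = \<kappa>" using \<kappa> by (auto simp: \<tau>0_def intro!: exp_Ln)
  have norm\<tau>0: "norm \<tau>0 \<le> 4"
  proof -
    have "\<kappa> \<noteq> 0" using \<kappa> by auto
    then have "Re \<tau>0 = 0" "\<bar>Im \<tau>0\<bar> \<le> pi"
      using \<kappa> mpi_less_Im_Ln[of \<kappa>] Im_Ln_le_pi[of \<kappa>] by (auto simp: \<tau>0_def)
    then show ?thesis using cmod_le[of \<tau>0] pi_less_4 by linarith
  qed
  define F where "F = (\<lambda>\<tau>. f (exp (c + of_real \<mu> * \<tau>)))"
  define t where "t = exp (c + of_real \<mu> * \<tau>0)"
  define p where "p = F \<tau>0"
  define u where "u = (of_real \<mu> * t) *s (\<chi> k. deriv (\<lambda>s. f s $ k) t)"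
  have F_deriv: "((\<lambda>\<tau>. F \<tau> $ k) has_field_derivative u $ k) (at \<tau>0)" for k
  proof -
    have "((\<lambda>s. f s $ k) has_field_derivative deriv (\<lambda>s. f s $ k) t) (at t)"
      using hol unfolding holomorphic_curve_def by (intro holomorphic_derivI[of _ UNIV]) auto
    moreover have "((\<lambda>\<tau>. exp (c + of_real \<mu> * \<tau>)) has_field_derivative of_real \<mu> * t) (at \<tau>0)"
      unfolding t_def by (auto intro!: derivative_eq_intros)
    ultimately show ?thesis
      unfolding F_def u_def t_def using DERIV_chain2 by (fastforce simp: mult.commute)
  qed
  have F_hol: "(\<lambda>\<tau>. F \<tau> $ k) holomorphic_on UNIV" for k
  proof -
    have "(\<lambda>s. f s $ k) \<circ> (\<lambda>\<tau>. exp (c + of_real \<mu> * \<tau>)) holomorphic_on UNIV"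
      using hol unfolding holomorphic_curve_def
      by (intro holomorphic_on_compose_gen[where t = UNIV] holomorphic_intros) auto
    then show ?thesis by (simp add: F_def o_def)
  qed
  have zero: "exp_form e p u = 0"
    using tangent[of t "of_real \<mu> * t"]
    unfolding pullback_def frechet_derivative_at[OF holomorphic_curve_has_derivative[OF hol], symmetric]
    by (simp add: p_def F_def t_def u_def)
  have nearF: "norm (F \<tau> $ k - exp \<tau> * a $ k) \<le> \<delta> * M" if "norm \<tau> \<le> 5" for \<tau> k
    using order_trans[OF Finite_Cartesian_Product.norm_nth_le near[OF that], of k]
    by (simp add: F_def a_def M_def)
  have p: "norm (p $ k - \<kappa> * a $ k) \<le> \<delta> * M" for k
    using nearF[of \<tau>0 k] norm\<tau>0 by (simp add: p_def exp\<tau>0)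
  have u: "norm (u $ k - \<kappa> * a $ k) \<le> \<delta> * M" for k
  proof -
    define D where "D = (\<lambda>\<tau>. F \<tau> $ k - exp \<tau> * a $ k)"
    have D_hol: "D holomorphic_on A" for A
      unfolding D_def using F_hol[of k] holomorphic_on_subset by (intro holomorphic_intros) blast
    have "norm ((deriv ^^ 1) D \<tau>0) \<le> fact 1 * (\<delta> * M) / 1 ^ 1"
    proof (rule Cauchy_inequality)
      show "norm (D x) \<le> \<delta> * M" if "norm (\<tau>0 - x) = 1" for x
      proof -
        have "norm x \<le> norm \<tau>0 + norm (\<tau>0 - x)" by (metis norm_triangle_sub norm_minus_commute)
        then show ?thesis unfolding D_def using that norm\<tau>0 by (intro nearF) linarith
      qed
    qed (auto intro: D_hol holomorphic_on_imp_continuous_on)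
    moreover have "(D has_field_derivative u $ k - \<kappa> * a $ k) (at \<tau>0)"
      unfolding D_def by (auto intro!: derivative_eq_intros F_deriv simp: exp\<tau>0)
    then have "deriv D \<tau>0 = u $ k - \<kappa> * a $ k" by (rule DERIV_imp_deriv)
    ultimately show ?thesis by simp
  qed
  have \<kappa>a: "norm (\<kappa> * a $ k) = M * norm (v $ k)" for k
    using \<kappa> M by (simp add: av norm_mult)
  have \<kappa>a_le: "norm (\<kappa> * a $ k) \<le> M" for k
    unfolding \<kappa>a using v_le[of k] M by (simp add: mult_left_le)
  have \<delta>M: "\<delta> * M \<le> M" using \<delta>1 M by (simp add: mult_le_cancel_right1)
  have p_le: "norm (p $ k) \<le> 2 * M" for k
    using norm_triangle_ineq2[of "p $ k" "\<kappa> * a $ k"] p[of k] \<kappa>a_le[of k] \<delta>M by linarith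
  have u_le: "norm (u $ k) \<le> 2 * M" for k
    using norm_triangle_ineq2[of "u $ k" "\<kappa> * a $ k"] u[of k] \<kappa>a_le[of k] \<delta>M by linarith
  have u_ge: "norm (u $ i) \<ge> 3 * \<gamma> / 4 * M"
  proof -
    have "M * \<gamma> \<le> norm (\<kappa> * a $ i)" unfolding \<kappa>a using vi M by (intro mult_left_mono) auto
    moreover have "norm (\<kappa> * a $ i) - norm (u $ i) \<le> \<delta> * M"
      using norm_triangle_ineq2[of "\<kappa> * a $ i" "u $ i"] u[of i] by (simp add: norm_minus_commute)
    ultimately show ?thesis by (simp add: \<delta>_def algebra_simps)
  qed
  have exponent: "\<bar>Re (\<eta> * p $ k) - M * Re (\<kappa> * \<eta> * v $ k)\<bar> \<le> \<delta> * M" if "\<eta> \<in> phases e k" for \<eta> k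
  proof -
    have "\<eta> * (\<kappa> * a $ k) = of_real M * (\<kappa> * \<eta> * v $ k)" by (simp add: av mult_ac)
    then have "M * Re (\<kappa> * \<eta> * v $ k) = Re (\<eta> * (\<kappa> * a $ k))"
      by (simp only: Re_complex_of_real Im_complex_of_real times_complex.sel(1)[of "of_real M"] mult_zero_left diff_zero)
    then have "\<bar>Re (\<eta> * p $ k) - M * Re (\<kappa> * \<eta> * v $ k)\<bar> = \<bar>Re (\<eta> * (p $ k - \<kappa> * a $ k))\<bar>"
      by (simp add: right_diff_distrib)
    also have "\<dots> \<le> norm (\<eta> * (p $ k - \<kappa> * a $ k))" by (rule abs_Re_le_cmod)
    also have "\<dots> \<le> \<delta> * M" using p[of k] norm_phase[OF that] by (simp add: norm_mult)
    finally show ?thesis .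
  qed
  define E where "E = (\<lambda>(k, \<eta>). \<eta> * exp (\<eta> * p $ k) * u $ k)"
  define Y where "Y = (\<Sum>j\<in>UNIV. xcoord p j * ycoord u j)"
  have norm_E: "norm (E (k, \<eta>)) = exp (Re (\<eta> * p $ k)) * norm (u $ k)" if "\<eta> \<in> phases e k" for k \<eta>
    using norm_phase[OF that] by (simp only: E_def prod.case norm_mult norm_exp_eq_Re mult_1)
  have main: "norm (E (i, \<omega>)) \<ge> exp (M * (g - \<gamma> / 4)) * (3 * \<gamma> / 4 * M)"
  proof -
    have "M * (g - \<gamma> / 4) \<le> Re (\<omega> * p $ i)"
    proof -
      have "M * (g - \<gamma> / 4) = M * g - \<delta> * M" by (simp add: \<delta>_def algebra_simps)
      then show ?thesis using exponent[OF \<omega>, folded g_def] by linarith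
    qed
    then show ?thesis
      unfolding norm_E[OF \<omega>] using u_ge \<gamma> M by (intro mult_mono) auto
  qed
  have other: "norm (E x) \<le> exp (M * (g - 3 * \<gamma> / 4)) * (2 * M)" if x: "x \<in> T - {(i, \<omega>)}" for x
  proof -
    obtain k \<eta> where k: "x = (k, \<eta>)" "\<eta> \<in> phases e k" "(k, \<eta>) \<noteq> (i, \<omega>)"
      using x by (auto simp: T_def)
    have "Re (\<eta> * p $ k) \<le> M * Re (\<kappa> * \<eta> * v $ k) + \<delta> * M" using exponent[OF k(2)] by linarith
    also have "M * Re (\<kappa> * \<eta> * v $ k) \<le> M * (g - \<gamma>)"
      using gap[OF k(2,3)] M unfolding g_def by (intro mult_left_mono) linarith+
    also have "M * (g - \<gamma>) + \<delta> * M = M * (g - 3 * \<gamma> / 4)" by (simp add: \<delta>_def algebra_simps)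
    finally have "Re (\<eta> * p $ k) \<le> M * (g - 3 * \<gamma> / 4)" by simp
    then show ?thesis
      unfolding k(1) norm_E[OF k(2)] using u_le by (intro mult_mono) auto
  qed
  have norm_Y: "norm Y \<le> real CARD('n) * (4 * M\<^sup>2)"
  proof -
    have "norm Y \<le> (\<Sum>j\<in>(UNIV :: 'n set). 4 * M\<^sup>2)"
      unfolding Y_def
    proof (rule sum_norm_le)
      fix j
      have "norm (xcoord p j * ycoord u j) \<le> (2 * M) * (2 * M)"
        unfolding norm_mult using p_le u_le M by (intro mult_mono) auto
      then show "norm (xcoord p j * ycoord u j) \<le> 4 * M\<^sup>2" by (simp add: power2_eq_square)
    qed
    then show ?thesis by simp
  qed
  have "exp_form e p u = (\<Sum>x\<in>T. E x) + Y"
    by (simp add: exp_form_def T_def E_def Y_def sum.Sigma)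
  also have "(\<Sum>x\<in>T. E x) = E (i, \<omega>) + (\<Sum>x\<in>T - {(i, \<omega>)}. E x)"
    using finT \<omega> by (intro sum.remove) (auto simp: T_def)
  finally have "E (i, \<omega>) = - ((\<Sum>x\<in>T - {(i, \<omega>)}. E x) + Y)"
    using zero by (simp add: algebra_simps eq_neg_iff_add_eq_0)
  then have "norm (E (i, \<omega>)) \<le> norm (\<Sum>x\<in>T - {(i, \<omega>)}. E x) + norm Y"
    by (metis norm_minus_cancel norm_triangle_ineq)
  also have "norm (\<Sum>x\<in>T - {(i, \<omega>)}. E x) \<le> (\<Sum>x\<in>T - {(i, \<omega>)}. exp (M * (g - 3 * \<gamma> / 4)) * (2 * M))"
    by (rule sum_norm_le) (rule other)
  also have "\<dots> = real (card (T - {(i, \<omega>)})) * (exp (M * (g - 3 * \<gamma> / 4)) * (2 * M))" by simp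
  also have "\<dots> \<le> real (card T) * (exp (M * (g - 3 * \<gamma> / 4)) * (2 * M))"
    using finT M by (intro mult_right_mono) (auto intro: card_mono)
  finally have "exp (M * (g - \<gamma> / 4)) * (3 * \<gamma> / 4 * M)
      \<le> real (card T) * (exp (M * (g - 3 * \<gamma> / 4)) * (2 * M)) + real CARD('n) * (4 * M\<^sup>2)"
    using main norm_Y by linarith
  also have "\<dots> = exp (M * (g - \<gamma> / 4)) * M *
      (2 * real (card T) * exp (- (\<gamma> / 2) * M) + 4 * real CARD('n) * M * exp (- (M * (g - \<gamma> / 4))))"
  proof -
    have 1: "exp (M * (g - 3 * \<gamma> / 4)) = exp (M * (g - \<gamma> / 4)) * exp (- (\<gamma> / 2) * M)"
      by (simp add: exp_add[symmetric] algebra_simps)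
    have 2: "exp (M * (g - \<gamma> / 4)) * exp (- (M * (g - \<gamma> / 4))) = 1"
      by (simp add: exp_add[symmetric])
    show ?thesis unfolding 1 using 2 by (simp add: algebra_simps power2_eq_square exp_minus)
  qed
  finally have "3 * \<gamma> / 4 \<le> 2 * real (card T) * exp (- (\<gamma> / 2) * M)
      + 4 * real CARD('n) * M * exp (- (M * (g - \<gamma> / 4)))"
    using M by (simp add: mult.assoc mult.commute[of _ M] mult_le_cancel_left_pos)
  also have "\<dots> \<le> 2 * real (card T) * exp (- (\<gamma> / 2) * M)
      + 4 * real CARD('n) * M * exp (- (3 * \<gamma> / 4) * M)"
  proof -
    have "M * (3 * \<gamma> / 4) \<le> M * (g - \<gamma> / 4)" using top M unfolding g_def by (intro mult_left_mono) linarith+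
    then show ?thesis using M by (intro add_left_mono mult_left_mono) (auto simp: mult.commute)
  qed
  finally show False using C[OF M(2)] by linarith
qed

theorem theorem1p1:
  shows "\<exists>\<alpha> :: 'n::finite cspace \<Rightarrow> 'n cspace \<Rightarrow> complex.
    holomorphic_contact_form \<alpha> \<and>
    (\<forall>f :: complex \<Rightarrow> 'n cspace.
       holomorphic_curve f \<and> (\<forall>t w. pullback f \<alpha> t w = 0) \<longrightarrow> f constant_on UNIV) \<and>
    \<not> contactomorphic \<alpha> standard_contact_form"
proof -
  obtain e' :: "'n + 'n + unit \<Rightarrow> nat" where e': "inj e'"
    using finite_imp_inj_to_nat_seg[of "UNIV :: ('n + 'n + unit) set"] by auto
  define e where "e = (\<lambda>i. if i = Inr (Inr ()) then 0 else Suc (e' i))"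
  have e: "inj e" using e' by (auto simp: e_def inj_def)
  have z: "e (Inr (Inr ())) = 0" by (simp add: e_def)
  have hyp: "f constant_on UNIV"
    if "holomorphic_curve f" "\<And>t w. pullback f (exp_form e) t w = 0" for f :: "complex \<Rightarrow> 'n cspace"
    using exp_form_entire_curve_constant[OF e] that by blast
  show ?thesis
    using exp_form_contact[of e, OF z] not_contactomorphic_standard[OF hyp] hyp by blast
qed

end
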